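(* Let $A$ be a covered semigroup. If $A$ is finitary, then $\operatorname{Spec}A$ is spatial, and $\operatorname{pt}(\operatorname{Spec}A)$ is quasi-spectral. If $A$ has a unit, then $\operatorname{pt}(\operatorname{Spec}A)$ is spectral.
   Context: A covered semigroup is a semigroup $(A,\cdot)$ with a closure operator $[-]$ on $(\mathcal P(A),\subset)$ satisfying $[S]\cdot[T]\subset[S\cdot T]$ for all $S,T\subset A$, where $S\cdot T=\{s\cdot t\mid s\in S,t\in T\}$. It is finitary if $[S]=\bigcup\{[S']\mid S'\subset S\text{ finite}\}$ for all $S\subset A$. A unit of $A$ is a unit for the multiplication $\cdot$. A flat is a subset $C\subset A$ with $[C]=C$. A suplattice is a poset with all suprema. A quantale is a suplattice with an associative multiplication distributing over arbitrary joins in each variable. The set $\mathcal C(A)$ of flats is a quantale with joins $[\bigcup_\alpha C_\alpha]$ and product $[C\cdot D]$. A frame is a suplattice in which binary meet distributes over arbitrary joins, regarded as a quantale with multiplication $\wedge$. A strong morphism of quantales is a map preserving arbitrary joins and products (units and top elements need not be preserved). For a quantale $\mathcal Q$, $\operatorname{Spec}\mathcal Q$ is the frame equipped with a strong morphism $\mathcal Q\to\operatorname{Spec}\mathcal Q$ that is initial among strong morphisms from $\mathcal Q$ to frames (this exists, by a theorem of Rosenthal). For a covered semigroup $A$, $\operatorname{Spec}A=\operatorname{Spec}\mathcal C(A)$. A point (prime) of a frame $\mathcal F$ is an element $P\in\mathcal F$, not the top element, such that $U\wedge V\le P$ implies $U\le P$ or $V\le P$. The set $\operatorname{pt}(\mathcal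 F)$ of points is topologized by the open sets $D(S)=\{P\text{ prime}\mid S\not\le P\}$, $S\in\mathcal F$. A frame is spatial if it is isomorphic to the frame of open sets of some topological space. A topological space is quasi-spectral if it is $T_0$ and sober, and it has a basis of quasi-compact opens that is closed under intersection. A space is spectral if it is quasi-spectral and quasi-compact. *)

theory Defs
  imports "HOL-Analysis.Analysis" "HOL-Algebra.Complete_Lattice"
begin

section \<open>Suplattices, quantales, frames\<close>

locale suplattice = partial_order +
  assumes sup_exists: "S \<subseteq> carrier L \<Longrightarrow> \<exists>s. is_lub L s S"

sublocale suplattice \<subseteq> complete_lattice
proof
  show "\<exists>s. is_lub L s S" if "S \<subseteq> carrier L" for S
    using that by (rule sup_exists)
  show "\<exists>i. is_glb L i S" if S: "S \<subseteq> carrier L" for S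
  proof -
    obtain i where i: "is_lub L i (Lower L S)"
      using sup_exists[of "Lower L S"] by auto
    have "is_glb L i S"
    proof (rule greatest_LowerI)
      show "i \<sqsubseteq> x" if "x \<in> S" for x
        using that S by (intro least_le[OF i] Upper_memI) auto
      show "y \<sqsubseteq> i" if "y \<in> Lower L S" for y
        using that by (intro least_Upper_above[OF i]) auto
    qed (use S i in auto)
    then show ?thesis ..
  qed
qed

lemma (in suplattice) sup_eqI: "is_lub L x S \<Longrightarrow> S \<subseteq> carrier L \<Longrightarrow> \<Squnion>S = x"
  by (rule supI) (auto intro: least_unique)

lemma (in suplattice) meet_eqI:
  "is_glb L z {x, y} \<Longrightarrow> x \<in> carrier L \<Longrightarrow> y \<in> carrier L \<Longrightarrow> x \<sqinter> y = z"
  unfolding meet_def by (rule infI) (auto intro: greatest_unique)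

record 'a quantale = "'a gorder" +
  qmult :: "['a, 'a] \<Rightarrow> 'a" (infixl \<open>\<odot>\<index>\<close> 70)

locale quantale = suplattice Q for Q (structure) +
  assumes qmult_closed: "x \<in> carrier Q \<Longrightarrow> y \<in> carrier Q \<Longrightarrow> x \<odot> y \<in> carrier Q"
    and qmult_assoc: "x \<in> carrier Q \<Longrightarrow> y \<in> carrier Q \<Longrightarrow> z \<in> carrier Q \<Longrightarrow>
      (x \<odot> y) \<odot> z = x \<odot> (y \<odot> z)"
    and qmult_sup: "x \<in> carrier Q \<Longrightarrow> S \<subseteq> carrier Q \<Longrightarrow> x \<odot> \<Squnion>S = \<Squnion>((\<lambda>s. x \<odot> s) ` S)"
    and sup_qmult: "x \<in> carrier Q \<Longrightarrow> S \<subseteq> carrier Q \<Longrightarrow> \<Squnion>S \<odot> x = \<Squnion>((\<lambda>s. s \<odot> x) ` S)"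

locale frame = suplattice F for F (structure) +
  assumes meet_sup: "x \<in> carrier F \<Longrightarrow> S \<subseteq> carrier F \<Longrightarrow> x \<sqinter> \<Squnion>S = \<Squnion>((\<lambda>s. x \<sqinter> s) ` S)"

definition frame_quantale :: "('a, 'b) gorder_scheme \<Rightarrow> 'a quantale"
  where "frame_quantale F =
    \<lparr>carrier = carrier F, eq = eq F, le = le F, qmult = (\<lambda>x y. x \<sqinter>\<^bsub>F\<^esub> y)\<rparr>"

lemma frame_quantale_simps [simp]:
  "carrier (frame_quantale F) = carrier F"
  "x \<sqsubseteq>\<^bsub>frame_quantale F\<^esub> y \<longleftrightarrow> x \<sqsubseteq>\<^bsub>F\<^esub> y"
  "x .=\<^bsub>frame_quantale F\<^esub> y \<longleftrightarrow> x .=\<^bsub>F\<^esub> y"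
  "x \<odot>\<^bsub>frame_quantale F\<^esub> y = x \<sqinter>\<^bsub>F\<^esub> y"
  "\<Squnion>\<^bsub>frame_quantale F\<^esub> S = \<Squnion>\<^bsub>F\<^esub> S"
  "is_lub (frame_quantale F) z S \<longleftrightarrow> is_lub F z S"
  by (simp_all add: frame_quantale_def Lattice.sup_def least_def Upper_def)

lemma (in frame) quantale_frame_quantale: "quantale (frame_quantale F)"
proof -
  have po: "partial_order (frame_quantale F)"
  proof
    show "(.=\<^bsub>frame_quantale F\<^esub>) = (=)"
      by (simp add: frame_quantale_def eq_is_equal)
  qed (simp_all add: eq_is_equal le_antisym, blast intro: le_trans)
  have sl: "suplattice (frame_quantale F)"
    unfolding suplattice_def suplattice_axioms_def using po sup_exists by simp
  show ?thesis
  proof (rule quantale.intro[OF sl], rule quantale_axioms.intro, unfold frame_quantale_simps)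
    fix x y z S assume x: "x \<in> carrier F"
    show "x \<sqinter> y \<in> carrier F" if "y \<in> carrier F"
      by (rule meet_closed[OF x that])
    show "(x \<sqinter> y) \<sqinter> z = x \<sqinter> (y \<sqinter> z)" if "y \<in> carrier F" "z \<in> carrier F"
      by (rule meet_assoc[OF x that])
    show "x \<sqinter> \<Squnion>S = \<Squnion>((\<lambda>s. x \<sqinter> s) ` S)" if "S \<subseteq> carrier F"
      by (rule meet_sup[OF x that])
    then show "\<Squnion>S \<sqinter> x = \<Squnion>((\<lambda>s. s \<sqinter> x) ` S)" if "S \<subseteq> carrier F"
      using that by (simp only: meet_comm[of _ x])
  qed
qed

text \<open>
  Units and top elements need not be preserved.
\<close>

definition strong_morphism ::
    "('a, 'c) quantale_scheme \<Rightarrow> ('b, 'd) quantale_scheme \<Rightarrow> ('a \<Rightarrow> 'b) \<Rightarrow> bool"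
  where "strong_morphism Q R \<phi> \<longleftrightarrow>
    \<phi> \<in> carrier Q \<rightarrow> carrier R \<and>
    (\<forall>S. S \<subseteq> carrier Q \<longrightarrow> \<phi> (\<Squnion>\<^bsub>Q\<^esub> S) = \<Squnion>\<^bsub>R\<^esub> (\<phi> ` S)) \<and>
    (\<forall>x\<in>carrier Q. \<forall>y\<in>carrier Q. \<phi> (x \<odot>\<^bsub>Q\<^esub> y) = \<phi> x \<odot>\<^bsub>R\<^esub> \<phi> y)"


section \<open>The spectrum of a quantale\<close>

definition initial_among_frames ::
    "'g itself \<Rightarrow> 'q quantale \<Rightarrow> 'f gorder \<Rightarrow> ('q \<Rightarrow> 'f) \<Rightarrow> bool"
  where "initial_among_frames T Q F \<phi> \<longleftrightarrow>
    (\<forall>(G :: 'g gorder) \<psi>. frame G \<and> strong_morphism Q (frame_quantale G) \<psi> \<longrightarrow>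
      (\<exists>!\<eta>. \<eta> \<in> extensional (carrier F) \<and>
        strong_morphism (frame_quantale F) (frame_quantale G) \<eta> \<and>
        (\<forall>x\<in>carrier Q. \<eta> (\<phi> x) = \<psi> x)))"

text \<open>
  A definition in HOL cannot quantify over the types carrying the competing frames.
  Initiality is therefore demanded among the frames carried by subsets of the type of \<open>Q\<close> and of
  the type of \<open>F\<close>. Together these two instances imply initiality among the frames carried by any
  type whatsoever (lemma \<open>is_Spec_initial\<close> below).
\<close>

definition is_Spec :: "'q quantale \<Rightarrow> 'f gorder \<Rightarrow> ('q \<Rightarrow> 'f) \<Rightarrow> bool"
  where "is_Spec Q F \<phi> \<longleftrightarrow>
    frame F \<and> strong_morphism Q (frame_quantale F) \<phi> \<and>
    initial_among_frames TYPE('q) Q F \<phi> \<and> initial_among_frames TYPE('f) Q F \<phi>"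


section \<open>Covered semigroups\<close>

definition setmult :: "('a \<Rightarrow> 'a \<Rightarrow> 'a) \<Rightarrow> 'a set \<Rightarrow> 'a set \<Rightarrow> 'a set"
  where "setmult mul S T = {mul s t | s t. s \<in> S \<and> t \<in> T}"

locale covered_semigroup =
  fixes A :: "'a set" and mul :: "'a \<Rightarrow> 'a \<Rightarrow> 'a" and cl :: "'a set \<Rightarrow> 'a set"
  assumes mul_closed: "a \<in> A \<Longrightarrow> b \<in> A \<Longrightarrow> mul a b \<in> A"
    and mul_assoc: "a \<in> A \<Longrightarrow> b \<in> A \<Longrightarrow> c \<in> A \<Longrightarrow> mul (mul a b) c = mul a (mul b c)"
    and cl_closed: "S \<subseteq> A \<Longrightarrow> cl S \<subseteq> A"
    and cl_extensive: "S \<subseteq> A \<Longrightarrow> S \<subseteq> cl S"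
    and cl_mono: "S \<subseteq> T \<Longrightarrow> T \<subseteq> A \<Longrightarrow> cl S \<subseteq> cl T"
    and cl_idem: "S \<subseteq> A \<Longrightarrow> cl (cl S) = cl S"
    and cl_mult: "S \<subseteq> A \<Longrightarrow> T \<subseteq> A \<Longrightarrow> setmult mul (cl S) (cl T) \<subseteq> cl (setmult mul S T)"

definition finitary :: "'a set \<Rightarrow> ('a set \<Rightarrow> 'a set) \<Rightarrow> bool"
  where "finitary A cl \<longleftrightarrow> (\<forall>S. S \<subseteq> A \<longrightarrow> cl S = \<Union>{cl S' | S'. S' \<subseteq> S \<and> finite S'})"

definition has_unit :: "'a set \<Rightarrow> ('a \<Rightarrow> 'a \<Rightarrow> 'a) \<Rightarrow> bool"
  where "has_unit A mul \<longleftrightarrow> (\<exists>e\<in>A. \<forall>a\<in>A. mul e a = a \<and> mul a e = a)"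

definition flats :: "'a set \<Rightarrow> ('a set \<Rightarrow> 'a set) \<Rightarrow> 'a set set"
  where "flats A cl = {C. C \<subseteq> A \<and> cl C = C}"

definition flat_quantale ::
    "'a set \<Rightarrow> ('a \<Rightarrow> 'a \<Rightarrow> 'a) \<Rightarrow> ('a set \<Rightarrow> 'a set) \<Rightarrow> 'a set quantale"
  where "flat_quantale A mul cl =
    \<lparr>carrier = flats A cl, eq = (=), le = (\<subseteq>), qmult = (\<lambda>C D. cl (setmult mul C D))\<rparr>"


section \<open>Points, spatial frames, spectral spaces\<close>

definition pt :: "('a, 'b) gorder_scheme \<Rightarrow> 'a set"
  where "pt F = {P \<in> carrier F. P \<noteq> \<top>\<^bsub>F\<^esub> \<and>
    (\<forall>U\<in>carrier F. \<forall>V\<in>carrier F. U \<sqinter>\<^bsub>F\<^esub> V \<sqsubseteq>\<^bsub>F\<^esub> P \<longrightarrow> U \<sqsubseteq>\<^bsub>F\<^esub> P \<or> V \<sqsubseteq>\<^bsub>F\<^esub> P)}"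

definition pt_open :: "('a, 'b) gorder_scheme \<Rightarrow> 'a \<Rightarrow> 'a set"
  where "pt_open F S = {P \<in> pt F. \<not> S \<sqsubseteq>\<^bsub>F\<^esub> P}"

definition pt_topology :: "('a, 'b) gorder_scheme \<Rightarrow> 'a topology"
  where "pt_topology F = topology (\<lambda>W. \<exists>S\<in>carrier F. W = pt_open F S)"

definition opens_frame :: "'a topology \<Rightarrow> 'a set gorder"
  where "opens_frame X = \<lparr>carrier = {U. openin X U}, eq = (=), le = (\<subseteq>)\<rparr>"

definition order_isomorphic :: "'a gorder \<Rightarrow> 'b gorder \<Rightarrow> bool"
  where "order_isomorphic L M \<longleftrightarrow> (\<exists>h. bij_betw h (carrier L) (carrier M) \<and> order_emb L M h)"

text \<open>
  The points of the space are taken from the type of the frame. This is no restriction: by lemma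
  \<open>spatialI\<close> below, a frame isomorphic to the opens of a space on any other type is spatial.
\<close>

definition spatial :: "'a gorder \<Rightarrow> bool"
  where "spatial F \<longleftrightarrow> (\<exists>X :: 'a topology. order_isomorphic F (opens_frame X))"

definition irreducible_closed :: "'a topology \<Rightarrow> 'a set \<Rightarrow> bool"
  where "irreducible_closed X C \<longleftrightarrow> closedin X C \<and> C \<noteq> {} \<and>
    (\<forall>C1 C2. closedin X C1 \<and> closedin X C2 \<and> C = C1 \<union> C2 \<longrightarrow> C = C1 \<or> C = C2)"

definition sober :: "'a topology \<Rightarrow> bool"
  where "sober X \<longleftrightarrow>
    (\<forall>C. irreducible_closed X C \<longrightarrow> (\<exists>!x. x \<in> topspace X \<and> C = X closure_of {x}))"

definition quasi_spectral :: "'a topology \<Rightarrow> bool"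
  where "quasi_spectral X \<longleftrightarrow> t0_space X \<and> sober X \<and>
    (\<exists>\<B>. (\<forall>U\<in>\<B>. openin X U \<and> compactin X U) \<and>
         (\<forall>U. openin X U \<longrightarrow> (\<exists>\<C>\<subseteq>\<B>. U = \<Union>\<C>)) \<and>
         (\<forall>U\<in>\<B>. \<forall>V\<in>\<B>. U \<inter> V \<in> \<B>))"

definition spectral :: "'a topology \<Rightarrow> bool"
  where "spectral X \<longleftrightarrow> quasi_spectral X \<and> compact_space X"


section \<open>Adequacy of the definitions\<close>

subsection \<open>The quantale of flats\<close>

context covered_semigroup
begin

lemma setmult_closed: "S \<subseteq> A \<Longrightarrow> T \<subseteq> A \<Longrightarrow> setmult mul S T \<subseteq> A"
  by (auto simp: setmult_def intro!: mul_closed)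

lemma setmultI: "s \<in> S \<Longrightarrow> t \<in> T \<Longrightarrow> mul s t \<in> setmult mul S T"
  by (auto simp: setmult_def)

lemma cl_flat: "S \<subseteq> A \<Longrightarrow> cl S \<in> flats A cl"
  by (simp add: flats_def cl_closed cl_idem)

lemma cl_least: "S \<subseteq> C \<Longrightarrow> C \<in> flats A cl \<Longrightarrow> cl S \<subseteq> C"
  using cl_mono[of S C] by (auto simp: flats_def)

lemma cl_setmult_cl:
  assumes "S \<subseteq> A" "T \<subseteq> A"
  shows "cl (setmult mul (cl S) (cl T)) = cl (setmult mul S T)"
proof
  show "cl (setmult mul (cl S) (cl T)) \<subseteq> cl (setmult mul S T)"
    by (intro cl_least cl_mult cl_flat setmult_closed assms)
  show "cl (setmult mul S T) \<subseteq> cl (setmult mul (cl S) (cl T))"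
    using cl_extensive[OF assms(1)] cl_extensive[OF assms(2)]
    by (intro cl_mono setmult_closed cl_closed assms) (auto simp: setmult_def)
qed

lemma is_lub_flats:
  assumes "\<S> \<subseteq> flats A cl"
  shows "is_lub (flat_quantale A mul cl) (cl (\<Union>\<S>)) \<S>"
proof (rule least_UpperI)
  have U: "\<Union>\<S> \<subseteq> A" using assms by (auto simp: flats_def)
  show "cl (\<Union>\<S>) \<in> carrier (flat_quantale A mul cl)"
    using cl_flat[OF U] by (simp add: flat_quantale_def)
  show "C \<sqsubseteq>\<^bsub>flat_quantale A mul cl\<^esub> cl (\<Union>\<S>)" if "C \<in> \<S>" for C
    using cl_extensive[OF U] that by (auto simp: flat_quantale_def)
  show "cl (\<Union>\<S>) \<sqsubseteq>\<^bsub>flat_quantale A mul cl\<^esub> D"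
    if "D \<in> Upper (flat_quantale A mul cl) \<S>" for D
  proof -
    have "D \<in> flats A cl" "\<Union>\<S> \<subseteq> D"
      using that assms by (auto simp: flat_quantale_def Upper_def)
    then show ?thesis by (simp add: flat_quantale_def cl_least)
  qed
qed (use assms in \<open>simp add: flat_quantale_def\<close>)

lemma suplattice_flats: "suplattice (flat_quantale A mul cl)"
proof -
  have "partial_order (flat_quantale A mul cl)"
    by unfold_locales (auto simp: flat_quantale_def)
  then show ?thesis
    by (rule suplattice.intro, intro suplattice_axioms.intro)
      (use is_lub_flats in \<open>auto simp: flat_quantale_def\<close>)
qed

lemma sup_flats: "\<S> \<subseteq> flats A cl \<Longrightarrow> \<Squnion>\<^bsub>flat_quantale A mul cl\<^esub> \<S> = cl (\<Union>\<S>)"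
  by (rule suplattice.sup_eqI[OF suplattice_flats is_lub_flats]) (auto simp: flat_quantale_def)

lemma cl_Union_cl:
  assumes "\<And>S. S \<in> \<S> \<Longrightarrow> S \<subseteq> A"
  shows "cl (\<Union>(cl ` \<S>)) = cl (\<Union>\<S>)"
proof
  show "cl (\<Union>(cl ` \<S>)) \<subseteq> cl (\<Union>\<S>)"
    by (rule cl_least, rule UN_least, rule cl_mono) (use assms in \<open>auto intro!: cl_flat\<close>)
  show "cl (\<Union>\<S>) \<subseteq> cl (\<Union>(cl ` \<S>))"
  proof (rule cl_mono)
    show "\<Union>\<S> \<subseteq> \<Union>(cl ` \<S>)" using cl_extensive[OF assms] by blast
    show "\<Union>(cl ` \<S>) \<subseteq> A" using cl_closed[OF assms] by blast
  qed
qed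

theorem quantale_flats: "quantale (flat_quantale A mul cl)"
proof -
  let ?Q = "flat_quantale A mul cl"
  have Qs: "carrier ?Q = flats A cl" "\<And>C D. C \<odot>\<^bsub>?Q\<^esub> D = cl (setmult mul C D)"
    by (simp_all add: flat_quantale_def)
  have fl: "C \<subseteq> A" "cl C = C" if "C \<in> flats A cl" for C
    using that by (auto simp: flats_def)
  have sm: "setmult mul C D \<subseteq> A" if "C \<in> flats A cl" "D \<in> flats A cl" for C D
    by (rule setmult_closed[OF fl(1) fl(1), OF that])
  have m: "cl (setmult mul C D) \<in> flats A cl" if "C \<in> flats A cl" "D \<in> flats A cl" for C D
    by (rule cl_flat[OF sm, OF that])
  have assoc: "cl (setmult mul (cl (setmult mul C D)) E) =
      cl (setmult mul C (cl (setmult mul D E)))"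
    if C: "C \<in> flats A cl" and D: "D \<in> flats A cl" and E: "E \<in> flats A cl" for C D E
  proof -
    have "setmult mul (setmult mul C D) E = setmult mul C (setmult mul D E)" (is "?l = ?r")
    proof (intro Set.set_eqI iffI)
      fix x assume "x \<in> ?l"
      then obtain c d e where x: "x = mul (mul c d) e" "c \<in> C" "d \<in> D" "e \<in> E"
        by (auto simp: setmult_def)
      have "x = mul c (mul d e)"
        unfolding x(1) using x(2-4) fl(1)[OF C] fl(1)[OF D] fl(1)[OF E] by (intro mul_assoc) blast+
      then show "x \<in> ?r" using x(2-4) by (simp add: setmultI)
    next
      fix x assume "x \<in> ?r"
      then obtain c d e where x: "x = mul c (mul d e)" "c \<in> C" "d \<in> D" "e \<in> E"
        by (auto simp: setmult_def)
      have "x = mul (mul c d) e"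
        unfolding x(1) using x(2-4) fl(1)[OF C] fl(1)[OF D] fl(1)[OF E]
        by (intro mul_assoc[symmetric]) blast+
      then show "x \<in> ?l" using x(2-4) by (simp add: setmultI)
    qed
    then show ?thesis
      using cl_setmult_cl[OF sm[OF C D] fl(1)[OF E]] cl_setmult_cl[OF fl(1)[OF C] sm[OF D E]]
      unfolding fl(2)[OF C] fl(2)[OF E] by (simp only:)
  qed
  have US: "\<Union>\<S> \<subseteq> A" if "\<S> \<subseteq> flats A cl" for \<S>
    using that fl(1) by blast
  have distl: "cl (setmult mul C (cl (\<Union>\<S>))) = cl (\<Union>((\<lambda>D. cl (setmult mul C D)) ` \<S>))"
    if C: "C \<in> flats A cl" and S: "\<S> \<subseteq> flats A cl" for C \<S>
  proof -
    have "cl (setmult mul C (cl (\<Union>\<S>))) = cl (setmult mul C (\<Union>\<S>))"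
      using cl_setmult_cl[OF fl(1)[OF C] US[OF S]] unfolding fl(2)[OF C] .
    also have "setmult mul C (\<Union>\<S>) = \<Union>(setmult mul C ` \<S>)"
      by (auto simp: setmult_def)
    also have "cl \<dots> = cl (\<Union>(cl ` setmult mul C ` \<S>))"
      by (rule cl_Union_cl[symmetric]) (use sm[OF C] S in blast)
    finally show ?thesis by (simp add: image_image)
  qed
  have distr: "cl (setmult mul (cl (\<Union>\<S>)) C) = cl (\<Union>((\<lambda>D. cl (setmult mul D C)) ` \<S>))"
    if C: "C \<in> flats A cl" and S: "\<S> \<subseteq> flats A cl" for C \<S>
  proof -
    have "cl (setmult mul (cl (\<Union>\<S>)) C) = cl (setmult mul (\<Union>\<S>) C)"
      using cl_setmult_cl[OF US[OF S] fl(1)[OF C]] unfolding fl(2)[OF C] .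
    also have "setmult mul (\<Union>\<S>) C = \<Union>((\<lambda>D. setmult mul D C) ` \<S>)"
      by (auto simp: setmult_def)
    also have "cl \<dots> = cl (\<Union>(cl ` (\<lambda>D. setmult mul D C) ` \<S>))"
      by (rule cl_Union_cl[symmetric]) (use sm[OF _ C] S in blast)
    finally show ?thesis by (simp add: image_image)
  qed
  have sup_mul: "\<Squnion>\<^bsub>?Q\<^esub> (h ` \<S>) = cl (\<Union>(h ` \<S>))"
    if "\<S> \<subseteq> flats A cl" "\<And>D. D \<in> flats A cl \<Longrightarrow> h D \<in> flats A cl" for h \<S>
    using that by (intro sup_flats) auto
  show ?thesis
  proof (rule quantale.intro[OF suplattice_flats], rule quantale_axioms.intro, unfold Qs)
    fix C D E \<S> assume C: "C \<in> flats A cl"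
    show "cl (setmult mul C D) \<in> flats A cl" if "D \<in> flats A cl"
      by (rule m[OF C that])
    show "cl (setmult mul (cl (setmult mul C D)) E) = cl (setmult mul C (cl (setmult mul D E)))"
      if "D \<in> flats A cl" "E \<in> flats A cl"
      by (rule assoc[OF C that])
    assume S: "\<S> \<subseteq> flats A cl"
    show "cl (setmult mul C (\<Squnion>\<^bsub>?Q\<^esub> \<S>)) = \<Squnion>\<^bsub>?Q\<^esub> ((\<lambda>D. cl (setmult mul C D)) ` \<S>)"
      unfolding sup_flats[OF S] distl[OF C S] by (rule sup_mul[symmetric, OF S m[OF C]])
    show "cl (setmult mul (\<Squnion>\<^bsub>?Q\<^esub> \<S>) C) = \<Squnion>\<^bsub>?Q\<^esub> ((\<lambda>D. cl (setmult mul D C)) ` \<S>)"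
      unfolding sup_flats[OF S] distr[OF C S] by (rule sup_mul[symmetric, OF S m[OF _ C]])
  qed
qed

end


subsection \<open>The universal property does not depend on the types involved\<close>

lemma (in quantale) strong_morphism_cong:
  assumes "\<And>x. x \<in> carrier Q \<Longrightarrow> \<phi> x = \<psi> x"
  shows "strong_morphism Q R \<phi> \<longleftrightarrow> strong_morphism Q R \<psi>"
proof -
  have "\<phi> ` S = \<psi> ` S" if "S \<subseteq> carrier Q" for S
    using assms that by (intro image_cong) auto
  then show ?thesis
    unfolding strong_morphism_def using assms qmult_closed
    by (auto simp: Pi_def)
qed

lemma strong_morphism_comp:
  assumes "strong_morphism P Q \<phi>" "strong_morphism Q R \<psi>"
  shows "strong_morphism P R (\<psi> \<circ> \<phi>)"
proof -
  have \<phi>: "\<phi> \<in> carrier P \<rightarrow> carrier Q" using assms(1) by (simp add: strong_morphism_def)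
  have "\<psi> (\<phi> (\<Squnion>\<^bsub>P\<^esub> S)) = \<Squnion>\<^bsub>R\<^esub> ((\<lambda>x. \<psi> (\<phi> x)) ` S)" if S: "S \<subseteq> carrier P" for S
  proof -
    have "\<phi> ` S \<subseteq> carrier Q" using \<phi> S by auto
    then have "\<psi> (\<Squnion>\<^bsub>Q\<^esub> (\<phi> ` S)) = \<Squnion>\<^bsub>R\<^esub> (\<psi> ` \<phi> ` S)"
      using assms(2) by (simp add: strong_morphism_def)
    then show ?thesis using assms(1) S by (simp add: strong_morphism_def image_image)
  qed
  then show ?thesis using assms by (simp add: strong_morphism_def comp_def Pi_iff)
qed

text \<open>
  A set \<open>K\<close> with a jointly injective family of maps to frames, closed under the joins and binary
  meets of these frames, is a frame.
\<close>

lemma joint_subframe: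
  fixes K :: "'k set" and G :: "'i \<Rightarrow> 'g gorder" and s :: "'i \<Rightarrow> 'k \<Rightarrow> 'g"
  assumes frames: "\<And>i. i \<in> I \<Longrightarrow> frame (G i)"
    and maps: "\<And>i a. i \<in> I \<Longrightarrow> a \<in> K \<Longrightarrow> s i a \<in> carrier (G i)"
    and inj: "\<And>a b. a \<in> K \<Longrightarrow> b \<in> K \<Longrightarrow> (\<And>i. i \<in> I \<Longrightarrow> s i a = s i b) \<Longrightarrow> a = b"
    and joins: "\<And>T. T \<subseteq> K \<Longrightarrow> \<exists>t\<in>K. \<forall>i\<in>I. s i t = \<Squnion>\<^bsub>G i\<^esub> (s i ` T)"
    and meets: "\<And>a b. a \<in> K \<Longrightarrow> b \<in> K \<Longrightarrow> \<exists>c\<in>K. \<forall>i\<in>I. s i c = s i a \<sqinter>\<^bsub>G i\<^esub> s i b"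
  defines "H \<equiv> \<lparr>carrier = K, eq = (=), le = (\<lambda>a b. \<forall>i\<in>I. s i a \<sqsubseteq>\<^bsub>G i\<^esub> s i b)\<rparr>"
  shows "frame H"
    and "\<And>i. i \<in> I \<Longrightarrow> strong_morphism (frame_quantale H) (frame_quantale (G i)) (s i)"
    and "\<And>(Q :: 'q quantale) \<phi>. quantale Q \<Longrightarrow> \<phi> \<in> carrier Q \<rightarrow> K \<Longrightarrow>
      (\<And>i. i \<in> I \<Longrightarrow> strong_morphism Q (frame_quantale (G i)) (s i \<circ> \<phi>)) \<Longrightarrow>
      strong_morphism Q (frame_quantale H) \<phi>"
proof -
  have H [simp]: "carrier H = K" "x .=\<^bsub>H\<^esub> y \<longleftrightarrow> x = y"
    "x \<sqsubseteq>\<^bsub>H\<^esub> y \<longleftrightarrow> (\<forall>i\<in>I. s i x \<sqsubseteq>\<^bsub>G i\<^esub> s i y)" for x y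
    by (simp_all add: H_def)
  have sl: "suplattice (G i)" and po: "partial_order (G i)" and wpo: "weak_partial_order (G i)"
    and cl: "weak_complete_lattice (G i)" and ll: "weak_lower_semilattice (G i)" if "i \<in> I" for i
  proof -
    interpret frame "G i" by (rule frames[OF that])
    show "suplattice (G i)" "partial_order (G i)" "weak_partial_order (G i)"
      "weak_complete_lattice (G i)" "weak_lower_semilattice (G i)"
      by unfold_locales
  qed
  have leH: "s i x \<sqsubseteq>\<^bsub>G i\<^esub> s i y" if "x \<sqsubseteq>\<^bsub>H\<^esub> y" "i \<in> I" for i x y
    using that by simp
  have poH: "partial_order H"
  proof
    show "x .=\<^bsub>H\<^esub> y"
      if xy: "x \<sqsubseteq>\<^bsub>H\<^esub> y" "y \<sqsubseteq>\<^bsub>H\<^esub> x" "x \<in> carrier H" "y \<in> carrier H" for x y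
    proof -
      have "s i x = s i y" if i: "i \<in> I" for i
        using partial_order.le_antisym[OF po[OF i] leH[OF xy(1) i] leH[OF xy(2) i]] maps[OF i] xy(3,4)
        by simp
      then show ?thesis using xy(3,4) by (simp add: inj)
    qed
    show "x \<sqsubseteq>\<^bsub>H\<^esub> z"
      if xy: "x \<sqsubseteq>\<^bsub>H\<^esub> y" "y \<sqsubseteq>\<^bsub>H\<^esub> z" "x \<in> carrier H" "y \<in> carrier H" "z \<in> carrier H" for x y z
    proof -
      have "s i x \<sqsubseteq>\<^bsub>G i\<^esub> s i z" if i: "i \<in> I" for i
        using weak_partial_order.le_trans[OF wpo[OF i] leH[OF xy(1) i] leH[OF xy(2) i]] maps[OF i]
          xy(3-5) by simp
      then show ?thesis by simp
    qed
    show "x \<sqsubseteq>\<^bsub>H\<^esub> x" if "x \<in> carrier H" for x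
      using weak_partial_order.le_refl[OF wpo maps] that by simp
  qed (auto simp: H_def)
  have lub: "is_lub H t T"
    if T: "T \<subseteq> K" and t: "t \<in> K" "\<And>i. i \<in> I \<Longrightarrow> s i t = \<Squnion>\<^bsub>G i\<^esub> (s i ` T)" for t T
  proof (rule least_UpperI)
    have im: "s i ` T \<subseteq> carrier (G i)" if "i \<in> I" for i
      using T maps that by auto
    show "x \<sqsubseteq>\<^bsub>H\<^esub> t" if x: "x \<in> T" for x
    proof -
      have "s i x \<sqsubseteq>\<^bsub>G i\<^esub> s i t" if i: "i \<in> I" for i
        unfolding t(2)[OF i]
        by (rule weak_complete_lattice.sup_upper[OF cl[OF i] im[OF i] imageI[OF x]])
      then show ?thesis by simp
    qed
    show "t \<sqsubseteq>\<^bsub>H\<^esub> u" if "u \<in> Upper H T" for u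
    proof -
      have u: "u \<in> K" "\<And>x. x \<in> T \<Longrightarrow> x \<sqsubseteq>\<^bsub>H\<^esub> u"
        using that T by (auto simp: Upper_def)
      have "s i t \<sqsubseteq>\<^bsub>G i\<^esub> s i u" if i: "i \<in> I" for i
        unfolding t(2)[OF i]
        by (rule weak_complete_lattice.sup_least[OF cl[OF i] im[OF i] maps[OF i u(1)]])
          (use leH[OF u(2) i] in blast)
      then show ?thesis by simp
    qed
  qed (use T t in auto)
  have slH: "suplattice H"
  proof (rule suplattice.intro[OF poH], rule suplattice_axioms.intro)
    fix T assume "T \<subseteq> carrier H"
    then have T: "T \<subseteq> K" by simp
    then obtain t where "t \<in> K" "\<forall>i\<in>I. s i t = \<Squnion>\<^bsub>G i\<^esub> (s i ` T)" using joins by blast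
    then show "\<exists>t. is_lub H t T" using lub[OF T] by blast
  qed
  interpret H: suplattice H by (rule slH)
  have supH: "s i (\<Squnion>\<^bsub>H\<^esub> T) = \<Squnion>\<^bsub>G i\<^esub> (s i ` T)" if "T \<subseteq> K" "i \<in> I" for i T
  proof -
    obtain t where t: "t \<in> K" "\<forall>i\<in>I. s i t = \<Squnion>\<^bsub>G i\<^esub> (s i ` T)" using joins[OF \<open>T \<subseteq> K\<close>] by blast
    then have "\<Squnion>\<^bsub>H\<^esub> T = t" using lub[OF \<open>T \<subseteq> K\<close>] that by (intro H.sup_eqI) simp_all
    then show ?thesis using t that by simp
  qed
  have meetH: "s i (a \<sqinter>\<^bsub>H\<^esub> b) = s i a \<sqinter>\<^bsub>G i\<^esub> s i b" if "a \<in> K" "b \<in> K" "i \<in> I" for i a b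
  proof -
    obtain c where c: "c \<in> K" "\<forall>i\<in>I. s i c = s i a \<sqinter>\<^bsub>G i\<^esub> s i b"
      using meets[OF \<open>a \<in> K\<close> \<open>b \<in> K\<close>] by blast
    have "is_glb H c {a, b}"
    proof (rule greatest_LowerI)
      have "s i c \<sqsubseteq>\<^bsub>G i\<^esub> s i a" "s i c \<sqsubseteq>\<^bsub>G i\<^esub> s i b" if i: "i \<in> I" for i
        using weak_lower_semilattice.meet_left[OF ll[OF i] maps[OF i \<open>a \<in> K\<close>] maps[OF i \<open>b \<in> K\<close>]]
          weak_lower_semilattice.meet_right[OF ll[OF i] maps[OF i \<open>a \<in> K\<close>] maps[OF i \<open>b \<in> K\<close>]]
          c(2) i by auto
      then show "c \<sqsubseteq>\<^bsub>H\<^esub> x" if "x \<in> {a, b}" for x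
        using that by auto
      show "y \<sqsubseteq>\<^bsub>H\<^esub> c" if "y \<in> Lower H {a, b}" for y
      proof -
        have y: "y \<in> K" "y \<sqsubseteq>\<^bsub>H\<^esub> a" "y \<sqsubseteq>\<^bsub>H\<^esub> b"
          using that \<open>a \<in> K\<close> \<open>b \<in> K\<close> by (auto simp: Lower_def)
        have "s i y \<sqsubseteq>\<^bsub>G i\<^esub> s i c" if i: "i \<in> I" for i
          using weak_lower_semilattice.meet_le[OF ll[OF i] leH[OF y(2) i] leH[OF y(3) i]
              maps[OF i \<open>a \<in> K\<close>] maps[OF i \<open>b \<in> K\<close>] maps[OF i y(1)]] c(2) i by simp
        then show ?thesis by simp
      qed
    qed (use c that in auto)
    then have "a \<sqinter>\<^bsub>H\<^esub> b = c" using that by (intro H.meet_eqI) simp_all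
    then show ?thesis using c that by simp
  qed
  have supK: "\<Squnion>\<^bsub>H\<^esub> T \<in> K" if "T \<subseteq> K" for T
    using H.sup_closed that by simp
  have meetK: "a \<sqinter>\<^bsub>H\<^esub> b \<in> K" if "a \<in> K" "b \<in> K" for a b
    using H.meet_closed that by simp
  show "frame H"
  proof
    fix x S assume "x \<in> carrier H" "S \<subseteq> carrier H"
    then have x: "x \<in> K" and S: "S \<subseteq> K" by auto
    show "x \<sqinter>\<^bsub>H\<^esub> \<Squnion>\<^bsub>H\<^esub> S = \<Squnion>\<^bsub>H\<^esub> ((\<lambda>s. x \<sqinter>\<^bsub>H\<^esub> s) ` S)"
    proof (rule inj)
      fix i assume i: "i \<in> I"
      have "s i (x \<sqinter>\<^bsub>H\<^esub> \<Squnion>\<^bsub>H\<^esub> S) = s i x \<sqinter>\<^bsub>G i\<^esub> \<Squnion>\<^bsub>G i\<^esub> (s i ` S)"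
        using meetH[OF x supK[OF S] i] supH[OF S i] by simp
      also have "\<dots> = \<Squnion>\<^bsub>G i\<^esub> ((\<lambda>t. s i x \<sqinter>\<^bsub>G i\<^esub> t) ` s i ` S)"
        using maps[OF i] x S by (intro frame.meet_sup[OF frames[OF i]]) auto
      also have "(\<lambda>t. s i x \<sqinter>\<^bsub>G i\<^esub> t) ` s i ` S = s i ` (\<lambda>t. x \<sqinter>\<^bsub>H\<^esub> t) ` S"
        unfolding image_image using meetH[OF x _ i] S by (intro image_cong) auto
      also have "\<Squnion>\<^bsub>G i\<^esub> \<dots> = s i (\<Squnion>\<^bsub>H\<^esub> ((\<lambda>t. x \<sqinter>\<^bsub>H\<^esub> t) ` S))"
        using meetK[OF x] S by (intro supH[symmetric] i) auto
      finally show "s i (x \<sqinter>\<^bsub>H\<^esub> \<Squnion>\<^bsub>H\<^esub> S) = s i (\<Squnion>\<^bsub>H\<^esub> ((\<lambda>s. x \<sqinter>\<^bsub>H\<^esub> s) ` S))" .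
    qed (use x S supK meetK in \<open>auto intro!: supK meetK\<close>)
  qed
  show "strong_morphism (frame_quantale H) (frame_quantale (G i)) (s i)" if "i \<in> I" for i
    using that maps supH meetH by (auto simp: strong_morphism_def)
  fix Q :: "'q quantale" and \<phi>
  assume "quantale Q" and \<phi>: "\<phi> \<in> carrier Q \<rightarrow> K"
    and sm: "\<And>i. i \<in> I \<Longrightarrow> strong_morphism Q (frame_quantale (G i)) (s i \<circ> \<phi>)"
  interpret Q: quantale Q by fact
  have "\<phi> (\<Squnion>\<^bsub>Q\<^esub> S) = \<Squnion>\<^bsub>H\<^esub> (\<phi> ` S)" if S: "S \<subseteq> carrier Q" for S
  proof (rule inj)
    have "\<phi> ` S \<subseteq> K" using S \<phi> by auto
    then show "\<Squnion>\<^bsub>H\<^esub> (\<phi> ` S) \<in> K"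
      and "\<And>i. i \<in> I \<Longrightarrow> s i (\<phi> (\<Squnion>\<^bsub>Q\<^esub> S)) = s i (\<Squnion>\<^bsub>H\<^esub> (\<phi> ` S))"
      using supK supH sm S by (auto simp: strong_morphism_def image_comp)
    show "\<phi> (\<Squnion>\<^bsub>Q\<^esub> S) \<in> K" using \<phi> Q.sup_closed[OF S] by auto
  qed
  moreover have "\<phi> (x \<odot>\<^bsub>Q\<^esub> y) = \<phi> x \<sqinter>\<^bsub>H\<^esub> \<phi> y" if "x \<in> carrier Q" "y \<in> carrier Q" for x y
    using that \<phi> sm
    by (intro inj meetK) (auto simp: strong_morphism_def meetH Pi_iff intro: Q.qmult_closed)
  ultimately show "strong_morphism Q (frame_quantale H) \<phi>"
    using \<phi> by (auto simp: strong_morphism_def)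
qed

lemma strong_morphism_id: "strong_morphism Q Q (\<lambda>x. x)"
  by (simp add: strong_morphism_def)

lemma is_Spec_surj:
  fixes F :: "'f gorder"
  assumes Q: "quantale Q" and spec: "is_Spec Q F \<phi>"
  shows "\<phi> ` carrier Q = carrier F"
proof
  interpret Q: quantale Q by fact
  interpret F: frame F using spec by (simp add: is_Spec_def)
  interpret FQ: quantale "frame_quantale F" by (rule F.quantale_frame_quantale)
  have \<phi>: "strong_morphism Q (frame_quantale F) \<phi>" using spec by (simp add: is_Spec_def)
  then have \<phi>c: "\<phi> \<in> carrier Q \<rightarrow> carrier F" by (simp add: strong_morphism_def)
  show "\<phi> ` carrier Q \<subseteq> carrier F" using \<phi>c by auto
  let ?K = "\<phi> ` carrier Q"
  let ?H = "\<lparr>carrier = ?K, eq = (=), le = (\<lambda>a b. \<forall>i\<in>UNIV::unit set. a \<sqsubseteq>\<^bsub>F\<^esub> b)\<rparr>"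
  have joins: "\<exists>t\<in>?K. \<forall>i\<in>UNIV::unit set. t = \<Squnion>\<^bsub>F\<^esub> ((\<lambda>x. x) ` T)" if T: "T \<subseteq> ?K" for T
  proof -
    obtain S where S: "S \<subseteq> carrier Q" "T = \<phi> ` S" using T by (rule subset_imageE)
    then have "\<Squnion>\<^bsub>F\<^esub> ((\<lambda>x. x) ` T) = \<phi> (\<Squnion>\<^bsub>Q\<^esub> S)" using \<phi> by (simp add: strong_morphism_def)
    also have "\<dots> \<in> ?K" using Q.sup_closed[OF S(1)] by (rule imageI)
    finally show ?thesis by (rule rev_bexI) simp
  qed
  have meets: "\<exists>c\<in>?K. \<forall>i\<in>UNIV::unit set. c = a \<sqinter>\<^bsub>F\<^esub> b" if ab: "a \<in> ?K" "b \<in> ?K" for a b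
  proof -
    obtain x y where xy: "x \<in> carrier Q" "y \<in> carrier Q" "a = \<phi> x" "b = \<phi> y" using ab by auto
    then have "a \<sqinter>\<^bsub>F\<^esub> b = \<phi> (x \<odot>\<^bsub>Q\<^esub> y)" using \<phi> by (simp add: strong_morphism_def)
    also have "\<dots> \<in> ?K" using Q.qmult_closed[OF xy(1,2)] by (rule imageI)
    finally show ?thesis by (rule rev_bexI) simp
  qed
  note sub = joint_subframe[where I = "UNIV :: unit set" and G = "\<lambda>_. F" and s = "\<lambda>_ x. x" and K = ?K,
      OF F.frame_axioms _ _ joins meets]
  have H: "frame ?H" by (rule sub(1); use \<phi>c in blast)
  have \<iota>: "strong_morphism (frame_quantale ?H) (frame_quantale F) (\<lambda>x. x)"
    by (rule sub(2); use \<phi>c in blast)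
  have "(\<lambda>x. x) \<circ> \<phi> = \<phi>" by (simp add: comp_def)
  then have \<phi>H: "strong_morphism Q (frame_quantale ?H) \<phi>"
    using \<phi> by (intro sub(3)) (use \<phi>c Q in auto)
  obtain \<eta> where \<eta>: "strong_morphism (frame_quantale F) (frame_quantale ?H) \<eta>"
    "\<forall>x\<in>carrier Q. \<eta> (\<phi> x) = \<phi> x"
  proof -
    have "initial_among_frames TYPE('f) Q F \<phi>" using spec by (simp add: is_Spec_def)
    from this[unfolded initial_among_frames_def, rule_format, OF conjI, OF H \<phi>H]
    show thesis using that by blast
  qed
  have 0: "strong_morphism (frame_quantale F) (frame_quantale F) \<eta>"
    using strong_morphism_comp[OF \<eta>(1) \<iota>] by (simp add: comp_def)
  have 1: "strong_morphism (frame_quantale F) (frame_quantale F) (restrict \<eta> (carrier F))"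
    using FQ.strong_morphism_cong[of "restrict \<eta> (carrier F)" \<eta> "frame_quantale F"] 0 by simp
  have 2: "strong_morphism (frame_quantale F) (frame_quantale F) (restrict (\<lambda>x. x) (carrier F))"
    using FQ.strong_morphism_cong[of "restrict (\<lambda>x. x) (carrier F)" "\<lambda>x. x" "frame_quantale F"]
      strong_morphism_id[of "frame_quantale F"] by simp
  have eq: "restrict \<eta> (carrier F) = restrict (\<lambda>x. x) (carrier F)"
  proof -
    have "initial_among_frames TYPE('f) Q F \<phi>" using spec by (simp add: is_Spec_def)
    from this[unfolded initial_among_frames_def, rule_format, OF conjI, OF F.frame_axioms \<phi>]
    have uniq: "\<zeta> = \<xi>" if
      "\<zeta> \<in> extensional (carrier F) \<and> strong_morphism (frame_quantale F) (frame_quantale F) \<zeta> \<and>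
        (\<forall>x\<in>carrier Q. \<zeta> (\<phi> x) = \<phi> x)"
      "\<xi> \<in> extensional (carrier F) \<and> strong_morphism (frame_quantale F) (frame_quantale F) \<xi> \<and>
        (\<forall>x\<in>carrier Q. \<xi> (\<phi> x) = \<phi> x)" for \<zeta> \<xi>
      using that by blast
    have "\<phi> x \<in> carrier F" if "x \<in> carrier Q" for x using \<phi>c that by auto
    then show ?thesis by (intro uniq conjI 1 2) (use \<eta>(2) in simp_all)
  qed
  have "\<eta> y = y" if "y \<in> carrier F" for y
    using fun_cong[OF eq, of y] that by simp
  moreover have "\<eta> y \<in> ?K" if "y \<in> carrier F" for y
    using \<eta>(1) that by (auto simp: strong_morphism_def)
  ultimately show "carrier F \<subseteq> ?K" by fastforce
qed

lemma quotient_frame: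
  fixes Q :: "'q quantale" and G :: "'i \<Rightarrow> 'g gorder" and \<psi> :: "'i \<Rightarrow> 'q \<Rightarrow> 'g"
  assumes Q: "quantale Q"
    and G: "\<And>i. i \<in> I \<Longrightarrow> frame (G i)"
    and \<psi>: "\<And>i. i \<in> I \<Longrightarrow> strong_morphism Q (frame_quantale (G i)) (\<psi> i)"
  shows "\<exists>(H :: 'q gorder) r. frame H \<and> strong_morphism Q (frame_quantale H) r \<and>
    r ` carrier Q = carrier H \<and>
    (\<forall>i\<in>I. strong_morphism (frame_quantale H) (frame_quantale (G i)) (\<psi> i)) \<and>
    (\<forall>i\<in>I. \<forall>x\<in>carrier Q. \<psi> i (r x) = \<psi> i x)"
proof -
  interpret Q: quantale Q by fact
  define r where "r x = (SOME y. y \<in> carrier Q \<and> (\<forall>i\<in>I. \<psi> i y = \<psi> i x))" for x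
  have r: "r x \<in> carrier Q" "\<And>i. i \<in> I \<Longrightarrow> \<psi> i (r x) = \<psi> i x" if "x \<in> carrier Q" for x
    using that someI[of "\<lambda>y. y \<in> carrier Q \<and> (\<forall>i\<in>I. \<psi> i y = \<psi> i x)" x]
    unfolding r_def by auto
  let ?K = "r ` carrier Q"
  have KQ: "?K \<subseteq> carrier Q" using r by auto
  have inj: "a = b" if ab: "a \<in> ?K" "b \<in> ?K" and eq: "\<And>i. i \<in> I \<Longrightarrow> \<psi> i a = \<psi> i b" for a b
  proof -
    obtain x y where xy: "x \<in> carrier Q" "y \<in> carrier Q" "a = r x" "b = r y" using ab by auto
    have "\<psi> i x = \<psi> i y" if "i \<in> I" for i
      using eq[OF that] r(2)[OF xy(1) that] r(2)[OF xy(2) that] xy(3,4) by simp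
    then have "(\<lambda>z. z \<in> carrier Q \<and> (\<forall>i\<in>I. \<psi> i z = \<psi> i x)) =
        (\<lambda>z. z \<in> carrier Q \<and> (\<forall>i\<in>I. \<psi> i z = \<psi> i y))"
      by auto
    then show ?thesis unfolding xy(3,4) r_def by simp
  qed
  have maps: "\<psi> i a \<in> carrier (G i)" if "i \<in> I" "a \<in> ?K" for i a
    using \<psi>[OF that(1)] KQ that(2) by (auto simp: strong_morphism_def)
  have joins: "\<exists>t\<in>?K. \<forall>i\<in>I. \<psi> i t = \<Squnion>\<^bsub>G i\<^esub> (\<psi> i ` T)" if "T \<subseteq> ?K" for T
  proof -
    have T: "T \<subseteq> carrier Q" using that KQ by auto
    have "\<psi> i (r (\<Squnion>\<^bsub>Q\<^esub> T)) = \<Squnion>\<^bsub>G i\<^esub> (\<psi> i ` T)" if i: "i \<in> I" for i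
      using r(2)[OF Q.sup_closed[OF T] i] \<psi>[OF i] T by (simp add: strong_morphism_def)
    then show ?thesis using Q.sup_closed[OF T] by blast
  qed
  have meets: "\<exists>c\<in>?K. \<forall>i\<in>I. \<psi> i c = \<psi> i a \<sqinter>\<^bsub>G i\<^esub> \<psi> i b" if "a \<in> ?K" "b \<in> ?K" for a b
  proof -
    have ab: "a \<in> carrier Q" "b \<in> carrier Q" using that KQ by auto
    have "\<psi> i (r (a \<odot>\<^bsub>Q\<^esub> b)) = \<psi> i a \<sqinter>\<^bsub>G i\<^esub> \<psi> i b" if i: "i \<in> I" for i
      using r(2)[OF Q.qmult_closed[OF ab] i] \<psi>[OF i] ab by (simp add: strong_morphism_def)
    then show ?thesis using Q.qmult_closed[OF ab] by blast
  qed
  let ?H = "\<lparr>carrier = ?K, eq = (=), le = (\<lambda>a b. \<forall>i\<in>I. \<psi> i a \<sqsubseteq>\<^bsub>G i\<^esub> \<psi> i b)\<rparr>"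
  note sub = joint_subframe[where G = G and s = \<psi> and K = ?K and I = I, OF G maps inj joins meets]
  have "frame ?H" by (rule sub(1); blast)
  moreover have "strong_morphism (frame_quantale ?H) (frame_quantale (G i)) (\<psi> i)"
    if "i \<in> I" for i
    by (rule sub(2); use that in blast)
  moreover have "strong_morphism Q (frame_quantale ?H) r"
  proof (rule sub(3))
    show "strong_morphism Q (frame_quantale (G i)) (\<psi> i \<circ> r)" if "i \<in> I" for i
      using \<psi>[OF that] Q.strong_morphism_cong[of "\<psi> i \<circ> r" "\<psi> i" "frame_quantale (G i)"] r(2)[OF _ that] by simp
  qed (use Q in auto)
  moreover have "r ` carrier Q = carrier ?H" by simp
  ultimately show ?thesis using r(2) by blast
qed

lemma initial_among_framesI:
  fixes F :: "'f gorder"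
  assumes F: "frame F" and surj: "\<phi> ` carrier Q = carrier F"
    and ex: "\<And>(G :: 'g gorder) \<psi>. frame G \<Longrightarrow> strong_morphism Q (frame_quantale G) \<psi> \<Longrightarrow>
      \<exists>\<eta>. strong_morphism (frame_quantale F) (frame_quantale G) \<eta> \<and>
        (\<forall>x\<in>carrier Q. \<eta> (\<phi> x) = \<psi> x)"
  shows "initial_among_frames TYPE('g) Q F \<phi>"
  unfolding initial_among_frames_def
proof (intro allI impI, elim conjE)
  interpret FQ: quantale "frame_quantale F" by (rule frame.quantale_frame_quantale[OF F])
  fix G :: "'g gorder" and \<psi>
  assume "frame G" "strong_morphism Q (frame_quantale G) \<psi>"
  from ex[OF this] obtain \<eta> where \<eta>: "strong_morphism (frame_quantale F) (frame_quantale G) \<eta>"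
    "\<forall>x\<in>carrier Q. \<eta> (\<phi> x) = \<psi> x" by blast
  show "\<exists>!\<eta>. \<eta> \<in> extensional (carrier F) \<and>
      strong_morphism (frame_quantale F) (frame_quantale G) \<eta> \<and> (\<forall>x\<in>carrier Q. \<eta> (\<phi> x) = \<psi> x)"
  proof (rule ex1I[of _ "restrict \<eta> (carrier F)"])
    have "strong_morphism (frame_quantale F) (frame_quantale G) (restrict \<eta> (carrier F))"
      using \<eta>(1) by (subst FQ.strong_morphism_cong[where \<psi> = \<eta>]) auto
    then show "restrict \<eta> (carrier F) \<in> extensional (carrier F) \<and>
      strong_morphism (frame_quantale F) (frame_quantale G) (restrict \<eta> (carrier F)) \<and>
      (\<forall>x\<in>carrier Q. restrict \<eta> (carrier F) (\<phi> x) = \<psi> x)"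
      using \<eta>(2) surj by auto
  next
    fix \<eta>'
    assume \<eta>': "\<eta>' \<in> extensional (carrier F) \<and>
      strong_morphism (frame_quantale F) (frame_quantale G) \<eta>' \<and> (\<forall>x\<in>carrier Q. \<eta>' (\<phi> x) = \<psi> x)"
    show "\<eta>' = restrict \<eta> (carrier F)"
    proof (rule extensionalityI)
      fix y assume y: "y \<in> carrier F"
      then obtain x where "x \<in> carrier Q" "y = \<phi> x" using surj by blast
      then show "\<eta>' y = restrict \<eta> (carrier F) y" using \<eta>(2) \<eta>' y by simp
    qed (use \<eta>' in auto)
  qed
qed

theorem is_Spec_initial:
  fixes Q :: "'q quantale" and F :: "'f gorder"
  assumes Q: "quantale Q" and spec: "is_Spec Q F \<phi>"
  shows "initial_among_frames TYPE('g) Q F \<phi>"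
proof (rule initial_among_framesI)
  show "frame F" using spec by (simp add: is_Spec_def)
  show "\<phi> ` carrier Q = carrier F" by (rule is_Spec_surj[OF assms])
  fix G :: "'g gorder" and \<psi>
  assume G: "frame G" "strong_morphism Q (frame_quantale G) \<psi>"
  obtain H :: "'q gorder" and r where H: "frame H" "strong_morphism Q (frame_quantale H) r"
    "strong_morphism (frame_quantale H) (frame_quantale G) \<psi>"
    "\<forall>x\<in>carrier Q. \<psi> (r x) = \<psi> x"
  proof -
    have "\<exists>(H :: 'q gorder) r. frame H \<and> strong_morphism Q (frame_quantale H) r \<and>
      r ` carrier Q = carrier H \<and>
      (\<forall>i\<in>UNIV :: unit set. strong_morphism (frame_quantale H) (frame_quantale G) \<psi>) \<and>
      (\<forall>i\<in>UNIV :: unit set. \<forall>x\<in>carrier Q. \<psi> (r x) = \<psi> x)"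
      by (rule quotient_frame[OF Q G])
    then show thesis using that by blast
  qed
  obtain \<eta> where \<eta>: "strong_morphism (frame_quantale F) (frame_quantale H) \<eta>"
    "\<forall>x\<in>carrier Q. \<eta> (\<phi> x) = r x"
    using spec H(1,2) unfolding is_Spec_def initial_among_frames_def by metis
  show "\<exists>\<eta>. strong_morphism (frame_quantale F) (frame_quantale G) \<eta> \<and>
      (\<forall>x\<in>carrier Q. \<eta> (\<phi> x) = \<psi> x)"
    using strong_morphism_comp[OF \<eta>(1) H(3)] \<eta>(2) H(4) by (intro exI[of _ "\<psi> \<circ> \<eta>"]) simp
qed

theorem is_Spec_exists:
  fixes Q :: "'q quantale"
  assumes Q: "quantale Q"
  shows "\<exists>(F :: 'q gorder) \<phi>. is_Spec Q F \<phi>"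
proof -
  let ?I = "{(G :: 'q gorder, \<psi>). frame G \<and> strong_morphism Q (frame_quantale G) \<psi>}"
  have "\<exists>(H :: 'q gorder) r. frame H \<and> strong_morphism Q (frame_quantale H) r \<and>
    r ` carrier Q = carrier H \<and>
    (\<forall>i\<in>?I. strong_morphism (frame_quantale H) (frame_quantale (fst i)) (snd i)) \<and>
    (\<forall>i\<in>?I. \<forall>x\<in>carrier Q. snd i (r x) = snd i x)"
    by (rule quotient_frame[OF Q]) auto
  then obtain H :: "'q gorder" and r where
    H: "frame H" "strong_morphism Q (frame_quantale H) r" "r ` carrier Q = carrier H"
    "\<forall>i\<in>?I. strong_morphism (frame_quantale H) (frame_quantale (fst i)) (snd i)"
    "\<forall>i\<in>?I. \<forall>x\<in>carrier Q. snd i (r x) = snd i x"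
    by (elim exE conjE)
  have "initial_among_frames TYPE('q) Q H r"
  proof (rule initial_among_framesI[OF H(1,3)])
    fix G :: "'q gorder" and \<psi>
    assume "frame G" "strong_morphism Q (frame_quantale G) \<psi>"
    then have "(G, \<psi>) \<in> ?I" by simp
    from bspec[OF H(4) this] bspec[OF H(5) this]
    show "\<exists>\<eta>. strong_morphism (frame_quantale H) (frame_quantale G) \<eta> \<and>
        (\<forall>x\<in>carrier Q. \<eta> (r x) = \<psi> x)"
      by auto
  qed
  then have "is_Spec Q H r" using H(1,2) by (simp add: is_Spec_def)
  then show ?thesis by blast
qed


subsection \<open>Points and spatiality\<close>

context frame
begin

lemma pt_open_sup:
  assumes "S \<subseteq> carrier F"
  shows "pt_open F (\<Squnion>S) = \<Union>(pt_open F ` S)"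
proof -
  have "\<Squnion>S \<sqsubseteq> P \<longleftrightarrow> (\<forall>s\<in>S. s \<sqsubseteq> P)" if "P \<in> carrier F" for P
    using that assms by (meson le_trans sup_closed sup_least sup_upper subsetD)
  then show ?thesis by (auto simp: pt_open_def pt_def)
qed

lemma pt_open_meet:
  assumes "U \<in> carrier F" "V \<in> carrier F"
  shows "pt_open F (U \<sqinter> V) = pt_open F U \<inter> pt_open F V"
proof -
  have "U \<sqinter> V \<sqsubseteq> P \<longleftrightarrow> U \<sqsubseteq> P \<or> V \<sqsubseteq> P" if "P \<in> pt F" for P
  proof -
    have "P \<in> carrier F" using that by (simp add: pt_def)
    then have "U \<sqinter> V \<sqsubseteq> P" if "U \<sqsubseteq> P \<or> V \<sqsubseteq> P"
      using that assms by (meson le_trans meet_closed meet_left meet_right)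
    then show ?thesis using that assms by (auto simp: pt_def)
  qed
  then show ?thesis by (auto simp: pt_open_def)
qed

theorem openin_pt_topology: "openin (pt_topology F) W \<longleftrightarrow> (\<exists>S\<in>carrier F. W = pt_open F S)"
proof -
  have "istopology (\<lambda>W. \<exists>S\<in>carrier F. W = pt_open F S)"
    unfolding istopology_def
  proof (intro conjI allI impI)
    fix V W assume "\<exists>S\<in>carrier F. V = pt_open F S" "\<exists>S\<in>carrier F. W = pt_open F S"
    then show "\<exists>S\<in>carrier F. V \<inter> W = pt_open F S" by (metis meet_closed pt_open_meet)
  next
    fix \<K> assume *: "\<forall>K\<in>\<K>. \<exists>S\<in>carrier F. K = pt_open F S"
    let ?S = "{S \<in> carrier F. pt_open F S \<in> \<K>}"
    have "\<Union>\<K> = pt_open F (\<Squnion>?S)" using * by (subst pt_open_sup) auto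
    then show "\<exists>S\<in>carrier F. \<Union>\<K> = pt_open F S" using sup_closed[of ?S] by auto
  qed
  then show ?thesis by (simp add: pt_topology_def topology_inverse')
qed

lemma topspace_pt_topology: "topspace (pt_topology F) = pt F"
proof
  show "topspace (pt_topology F) \<subseteq> pt F"
    using openin_topspace[of "pt_topology F"] unfolding openin_pt_topology
    by (auto simp: pt_open_def)
  have "P = \<top>" if "P \<in> carrier F" "\<top> \<sqsubseteq> P" for P
    using that by (meson le_antisym top_closed top_higher)
  then have "pt F = pt_open F \<top>" by (auto simp: pt_open_def pt_def)
  then have "openin (pt_topology F) (pt F)" unfolding openin_pt_topology using top_closed by blast
  then show "pt F \<subseteq> topspace (pt_topology F)" by (rule openin_subset)
qed

end

theorem spatialI:
  fixes F :: "'f gorder" and X :: "'b topology"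
  assumes "order_isomorphic F (opens_frame X)"
  shows "spatial F"
proof -
  obtain h where h: "bij_betw h (carrier F) {U. openin X U}" "order_emb F (opens_frame X) h"
    using assms by (auto simp: order_isomorphic_def opens_frame_def)
  define p where "p x = inv_into (carrier F) h (X interior_of (topspace X - {x}))" for x
  have hp: "h (p x) = X interior_of (topspace X - {x})" for x
    unfolding p_def using h(1) by (intro f_inv_into_f) (auto simp: bij_betw_def)
  have sep: "x \<in> U \<longleftrightarrow> y \<in> U"
    if "p x = p y" "openin X U" "x \<in> topspace X" "y \<in> topspace X" for x y U
  proof -
    have "z \<notin> U \<longleftrightarrow> U \<subseteq> h (p z)" for z
      unfolding hp using that(2) openin_subset[OF that(2)]
      by (metis Diff_empty Diff_insert_absorb Diff_subset insert_Diff interior_of_maximal_eq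
          interior_of_subset singletonI subset_Diff_insert subset_trans)
    then show ?thesis using that by metis
  qed
  define Y where "Y = topology (\<lambda>V. \<exists>U. openin X U \<and> V = p ` U)"
  have inter: "p ` U \<inter> p ` V = p ` (U \<inter> V)" if "openin X U" "openin X V" for U V
  proof
    show "p ` U \<inter> p ` V \<subseteq> p ` (U \<inter> V)"
    proof
      fix z assume "z \<in> p ` U \<inter> p ` V"
      then obtain x y where xy: "x \<in> U" "y \<in> V" "z = p x" "p x = p y" by auto
      then have "x \<in> V"
        using sep[OF xy(4) that(2)] openin_subset[OF that(1)] openin_subset[OF that(2)] by blast
      then show "z \<in> p ` (U \<inter> V)" using xy by blast
    qed
  qed auto
  have "istopology (\<lambda>V. \<exists>U. openin X U \<and> V = p ` U)"
    unfolding istopology_def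
  proof (intro conjI allI impI)
    fix V W assume "\<exists>U. openin X U \<and> V = p ` U" "\<exists>U. openin X U \<and> W = p ` U"
    then show "\<exists>U. openin X U \<and> V \<inter> W = p ` U" using inter by (metis openin_Int)
  next
    fix \<K> assume *: "\<forall>K\<in>\<K>. \<exists>U. openin X U \<and> K = p ` U"
    have "\<Union>\<K> = p ` \<Union>{U. openin X U \<and> p ` U \<in> \<K>}"
      using * by (auto simp: image_Union) metis
    then show "\<exists>U. openin X U \<and> \<Union>\<K> = p ` U"
      by (intro exI[of _ "\<Union>{U. openin X U \<and> p ` U \<in> \<K>}"]) auto
  qed
  then have oY: "openin Y V \<longleftrightarrow> (\<exists>U. openin X U \<and> V = p ` U)" for V
    by (simp add: Y_def topology_inverse')
  have emb: "p ` U \<subseteq> p ` V \<longleftrightarrow> U \<subseteq> V" if "openin X U" "openin X V" for U V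
    using sep[OF _ that(2)] openin_subset[OF that(1)] openin_subset[OF that(2)] by blast
  have po: "weak_partial_order (opens_frame Y)"
    by unfold_locales (auto simp: opens_frame_def)
  have "bij_betw (image p) {U. openin X U} {V. openin Y V}"
    unfolding bij_betw_def inj_on_def using oY
    by (auto simp: set_eq_subset emb)
  then have "bij_betw (image p \<circ> h) (carrier F) {V. openin Y V}"
    by (rule bij_betw_trans[OF h(1)])
  moreover have "order_emb F (opens_frame Y) (image p \<circ> h)"
  proof -
    have "openin X (h x)" if "x \<in> carrier F" for x
      using h(1) that by (auto simp: bij_betw_def)
    then show ?thesis
      using h(2) po unfolding order_emb_def by (simp add: opens_frame_def emb)
  qed
  ultimately have "order_isomorphic F (opens_frame Y)"
    unfolding order_isomorphic_def by (auto simp: opens_frame_def)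
  then show ?thesis unfolding spatial_def ..
qed

end

theory Submission
  imports Defs
begin

text \<open>
  The image in \<open>Spec A\<close> of a product of elements of \<open>A\<close> is a meet, so points of \<open>Spec A\<close> correspond to
  proper flats \<open>P\<close> such that \<open>ab \<in> P\<close> iff \<open>a \<in> P\<close> or \<open>b \<in> P\<close>. The flats
  coming from arbitrary elements of \<open>Spec A\<close> are two-sided ideals \<open>C\<close> with \<open>a\<^sup>2 \<in> C \<Longrightarrow> a \<in> C\<close>.
  As in reduced rings, membership of a product in such a \<open>C\<close> does not depend on the order or
  multiplicity of its factors, so \<open>(C : x)\<close> is again of this kind. Finitariness makes these flats
  stable under directed unions. Hence Zorn's lemma gives one that is maximal among those avoiding a
  given \<open>a\<close>, and it is prime. Thus points separate elements of \<open>Spec A\<close>, and directed unions also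
  show that the basic open sets \<open>D(a)\<close> are quasi-compact; they form a basis closed under
  intersection because \<open>D(a) \<inter> D(b) = D(ab)\<close>.
\<close>

section \<open>The space of points of a frame\<close>

context frame
begin

section \<open>Order facts and topology of the space of points\<close>

lemma le_sup_iff:
  assumes "S \<subseteq> carrier F" "y \<in> carrier F"
  shows "\<Squnion>S \<sqsubseteq> y \<longleftrightarrow> (\<forall>s\<in>S. s \<sqsubseteq> y)"
  using assms by (meson le_trans sup_closed sup_least sup_upper subsetD)

lemma le_meet_iff:
  assumes "x \<in> carrier F" "y \<in> carrier F" "z \<in> carrier F"
  shows "z \<sqsubseteq> x \<sqinter> y \<longleftrightarrow> z \<sqsubseteq> x \<and> z \<sqsubseteq> y"
  using assms by (meson le_trans meet_closed meet_left meet_right meet_le)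

lemma pt_carrier: "P \<in> pt F \<Longrightarrow> P \<in> carrier F"
  by (simp add: pt_def)

lemma pt_open_top: "pt_open F \<top> = pt F"
  unfolding pt_open_def pt_def by (auto dest: le_antisym[OF top_higher])

lemma pt_open_subset: "pt_open F S \<subseteq> pt F"
  by (auto simp: pt_open_def)

lemma openin_pt_open: "S \<in> carrier F \<Longrightarrow> openin (pt_topology F) (pt_open F S)"
  by (auto simp: openin_pt_topology)

lemma t0_space_pt_topology: "t0_space (pt_topology F)"
  unfolding t0_space_def topspace_pt_topology
proof (intro ballI impI)
  fix P P' assume P: "P \<in> pt F" "P' \<in> pt F" "P \<noteq> P'"
  then have "\<not> P \<sqsubseteq> P' \<or> \<not> P' \<sqsubseteq> P" by (meson le_antisym pt_carrier)
  \<comment> \<open>No point lies in the open set that it names itself, so one of the two named sets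
    separates the points.\<close>
  then have "P \<in> pt_open F P' \<and> P' \<notin> pt_open F P' \<or> P \<notin> pt_open F P \<and> P' \<in> pt_open F P"
    using P by (auto simp: pt_open_def pt_carrier)
  then show "\<exists>U. openin (pt_topology F) U \<and> (P \<notin> U) = (P' \<in> U)"
    using P by (meson openin_pt_open pt_carrier)
qed

text \<open>The complement of \<open>pt_open F S\<close> contains \<open>P\<close> exactly when
  \<open>S\<close> lies below \<open>P\<close>, so the smallest closed set comes from
  \<open>S = P\<close>. Specialization is thus the frame order on points.\<close>

lemma closure_of_point:
  assumes "P \<in> pt F"
  shows "pt_topology F closure_of {P} = {P' \<in> pt F. P \<sqsubseteq> P'}"
proof -
  have "P' \<in> pt_topology F closure_of {P} \<longleftrightarrow> P \<sqsubseteq> P'" if P': "P' \<in> pt F" for P'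
  proof -
    have "P' \<in> pt_topology F closure_of {P} \<longleftrightarrow>
        (\<forall>S\<in>carrier F. P' \<in> pt_open F S \<longrightarrow> P \<in> pt_open F S)"
      using P' by (auto simp: in_closure_of topspace_pt_topology openin_pt_topology)
    also have "\<dots> \<longleftrightarrow> (\<forall>S\<in>carrier F. S \<sqsubseteq> P \<longrightarrow> S \<sqsubseteq> P')"
      using P' assms by (auto simp: pt_open_def)
    also have "\<dots> \<longleftrightarrow> P \<sqsubseteq> P'"
      using P' assms by (meson le_refl le_trans pt_carrier)
    finally show ?thesis .
  qed
  then show ?thesis
    using closure_of_subset_topspace[of "pt_topology F" "{P}"]
    by (auto simp: topspace_pt_topology)
qed

text \<open>The generic point of an irreducible closed \<open>C\<close> is the largest
  \<open>T\<close> whose open set misses \<open>C\<close>. The complement of that open set is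
  \<open>C\<close>; irreducibility makes \<open>T\<close> prime, and non-emptiness of
  \<open>C\<close> keeps it from being the top.\<close>

lemma sober_pt_topology: "sober (pt_topology F)"
  unfolding sober_def
proof (intro allI impI)
  fix C assume irr: "irreducible_closed (pt_topology F) C"
  then have cC: "closedin (pt_topology F) C" and ne: "C \<noteq> {}"
    by (auto simp: irreducible_closed_def)
  then have Cpt: "C \<subseteq> pt F" by (metis closedin_subset topspace_pt_topology)
  let ?\<S> = "{S \<in> carrier F. pt_open F S \<inter> C = {}}"
  define T where "T = \<Squnion>?\<S>"
  have T: "T \<in> carrier F" unfolding T_def by (rule sup_closed) auto
  have le_T: "S \<sqsubseteq> T" if "S \<in> carrier F" "pt_open F S \<inter> C = {}" for S
    unfolding T_def using that by (intro sup_upper) auto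
  have T_C: "pt_open F T \<inter> C = {}"
    unfolding T_def by (subst pt_open_sup) auto
  have C_eq: "C = pt F - pt_open F T"
  proof -
    obtain S where S: "S \<in> carrier F" "pt F - C = pt_open F S"
      using cC by (auto simp: closedin_def topspace_pt_topology openin_pt_topology)
    then have ST: "S \<sqsubseteq> T" by (intro le_T) auto
    have "pt_open F S \<subseteq> pt_open F T"
      using le_trans[OF ST _ S(1) T] by (auto simp: pt_open_def pt_carrier)
    then show ?thesis using S T_C Cpt by blast
  qed
  have prime: "U \<sqsubseteq> T \<or> V \<sqsubseteq> T"
    if U: "U \<in> carrier F" and V: "V \<in> carrier F" and UV: "U \<sqinter> V \<sqsubseteq> T" for U V
  proof -
    have closed: "closedin (pt_topology F) (C - pt_open F W)" if "W \<in> carrier F" for W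
      by (intro closedin_diff cC openin_pt_open that)
    have "pt_open F (U \<sqinter> V) \<subseteq> pt_open F T"
      using le_trans[OF UV _ meet_closed[OF U V] T] by (auto simp: pt_open_def pt_carrier)
    \<comment> \<open>No point of \<open>C\<close> lies in both open sets, so two closed pieces
      cover \<open>C\<close>; by irreducibility one of them is all of \<open>C\<close>.\<close>
    then have "C = (C - pt_open F U) \<union> (C - pt_open F V)"
      using pt_open_meet[OF U V] T_C by blast
    then have "C = C - pt_open F U \<or> C = C - pt_open F V"
      using irr closed[OF U] closed[OF V] unfolding irreducible_closed_def by blast
    then have "pt_open F U \<inter> C = {} \<or> pt_open F V \<inter> C = {}" by blast
    then show ?thesis using le_T[OF U] le_T[OF V] by blast
  qed
  have "T \<noteq> \<top>" using C_eq ne pt_open_top by auto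
  then have Tpt: "T \<in> pt F" using T prime by (auto simp: pt_def)
  have C_cl: "C = pt_topology F closure_of {T}"
    unfolding closure_of_point[OF Tpt] C_eq by (auto simp: pt_open_def)
  show "\<exists>!x. x \<in> topspace (pt_topology F) \<and> C = pt_topology F closure_of {x}"
  proof (rule ex1I[of _ T])
    show "T \<in> topspace (pt_topology F) \<and> C = pt_topology F closure_of {T}"
      using Tpt C_cl by (simp add: topspace_pt_topology)
    fix P assume "P \<in> topspace (pt_topology F) \<and> C = pt_topology F closure_of {P}"
    then have P: "P \<in> pt F" "{P' \<in> pt F. P \<sqsubseteq> P'} = {P' \<in> pt F. T \<sqsubseteq> P'}"
      using C_cl closure_of_point Tpt by (auto simp: topspace_pt_topology)
    \<comment> \<open>Each of \<open>P\<close> and \<open>T\<close> lies in its own closure, hence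
      in that of the other, which gives both inequalities.\<close>
    have "T \<in> {P' \<in> pt F. P \<sqsubseteq> P'}" unfolding P(2) using Tpt T by simp
    moreover have "P \<in> {P' \<in> pt F. T \<sqsubseteq> P'}" unfolding P(2)[symmetric] using P(1) pt_carrier by simp
    ultimately have "P \<sqsubseteq> T" "T \<sqsubseteq> P" by simp_all
    then show "P = T" using pt_carrier[OF P(1)] T by (rule le_antisym)
  qed
qed

end

text \<open>The isomorphism is \<open>pt_open F\<close>, onto the opens of the space of points. It
  is onto by the choice of topology; separation makes it reflect the order, hence injective.\<close>

lemma spatial_if_points_separate:
  fixes F :: "'f gorder"
  assumes F: "frame F"
    and sep: "\<And>U V. U \<in> carrier F \<Longrightarrow> V \<in> carrier F \<Longrightarrow> \<not> U \<sqsubseteq>\<^bsub>F\<^esub> V \<Longrightarrow>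
      \<exists>P\<in>pt F. V \<sqsubseteq>\<^bsub>F\<^esub> P \<and> \<not> U \<sqsubseteq>\<^bsub>F\<^esub> P"
  shows "spatial F"
proof -
  interpret frame F by fact
  have emb: "pt_open F U \<subseteq> pt_open F V \<longleftrightarrow> U \<sqsubseteq>\<^bsub>F\<^esub> V"
    if UV: "U \<in> carrier F" "V \<in> carrier F" for U V
  proof
    show "U \<sqsubseteq>\<^bsub>F\<^esub> V" if "pt_open F U \<subseteq> pt_open F V"
      using sep[OF UV] that unfolding pt_open_def by blast
    show "pt_open F U \<subseteq> pt_open F V" if "U \<sqsubseteq>\<^bsub>F\<^esub> V"
      using le_trans[OF that _ UV] by (auto simp: pt_open_def pt_carrier)
  qed
  have inj: "inj_on (pt_open F) (carrier F)"
    by (rule inj_onI, rule le_antisym) (auto simp: emb[symmetric])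
  have "weak_partial_order (opens_frame (pt_topology F))"
    by unfold_locales (auto simp: opens_frame_def)
  then have "order_emb F (opens_frame (pt_topology F)) (pt_open F)"
    unfolding order_emb_def
    using weak_partial_order_axioms
    by (simp add: opens_frame_def emb openin_pt_open)
  moreover have "bij_betw (pt_open F) (carrier F) (carrier (opens_frame (pt_topology F)))"
    using inj by (auto simp: bij_betw_def opens_frame_def openin_pt_topology)
  ultimately show ?thesis unfolding spatial_def order_isomorphic_def by blast
qed


section \<open>Radical and prime flats\<close>

context covered_semigroup
begin

text \<open>The counterpart of a completely semiprime ideal in a noncommutative ring.\<close>

definition radical_flat :: "'a set \<Rightarrow> bool"
  where "radical_flat C \<longleftrightarrow> C \<in> flats A cl \<and>
    (\<forall>x\<in>A. \<forall>y\<in>A. x \<in> C \<or> y \<in> C \<longrightarrow> mul x y \<in> C) \<and>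
    (\<forall>x\<in>A. mul x x \<in> C \<longrightarrow> x \<in> C)"

text \<open>One equivalence encodes both the ideal condition and primality. The carrier
  \<open>A\<close> qualifies too; properness enters in \<open>pt_prime_flat\<close> through a
  witness outside \<open>P\<close>.\<close>

definition prime_flat :: "'a set \<Rightarrow> bool"
  where "prime_flat P \<longleftrightarrow> P \<in> flats A cl \<and>
    (\<forall>x\<in>A. \<forall>y\<in>A. mul x y \<in> P \<longleftrightarrow> x \<in> P \<or> y \<in> P)"

text \<open>For \<open>S\<close> inside \<open>A\<close> the intersected family contains
  \<open>A\<close>. Applied to a union of radical flats, this closure gives their join.\<close>

definition radical :: "'a set \<Rightarrow> 'a set"
  where "radical S = \<Inter>{C. radical_flat C \<and> S \<subseteq> C}"

section \<open>Algebra of radical flats\<close>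

lemma flat_subset: "C \<in> flats A cl \<Longrightarrow> C \<subseteq> A"
  by (simp add: flats_def)

lemma flatI: "C \<subseteq> A \<Longrightarrow> cl C \<subseteq> C \<Longrightarrow> C \<in> flats A cl"
  using cl_extensive by (auto simp: flats_def)

lemma radical_flat_flat: "radical_flat C \<Longrightarrow> C \<in> flats A cl"
  unfolding radical_flat_def by blast

lemma radical_flat_subset: "radical_flat C \<Longrightarrow> C \<subseteq> A"
  by (rule flat_subset[OF radical_flat_flat])

lemma cl_subset_iff:
  assumes "S \<subseteq> A" "C \<in> flats A cl"
  shows "cl S \<subseteq> C \<longleftrightarrow> S \<subseteq> C"
  using cl_extensive[OF assms(1)] cl_least[OF _ assms(2)] by blast

lemma radical_flat_mul:
  assumes "radical_flat C" "x \<in> A" "y \<in> A" "x \<in> C \<or> y \<in> C"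
  shows "mul x y \<in> C"
  using assms unfolding radical_flat_def by blast

lemma radical_flat_square:
  assumes "radical_flat C" "x \<in> A" "mul x x \<in> C"
  shows "x \<in> C"
  using assms unfolding radical_flat_def by blast

text \<open>The square of \<open>yx\<close> is \<open>y(xy)x\<close>, which has \<open>xy\<close> as
  a factor.\<close>

lemma radical_flat_commute:
  assumes C: "radical_flat C" and x: "x \<in> A" and y: "y \<in> A" and xy: "mul x y \<in> C"
  shows "mul y x \<in> C"
proof (rule radical_flat_square[OF C])
  have "mul (mul y x) (mul y x) = mul y (mul (mul x y) x)"
    using x y by (simp add: mul_assoc mul_closed)
  also have "\<dots> \<in> C"
  proof -
    have "mul (mul x y) x \<in> C" using radical_flat_mul[OF C mul_closed[OF x y] x] xy by simp
    then show ?thesis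
      using radical_flat_mul[OF C y mul_closed[OF mul_closed[OF x y] x]] by simp
  qed
  finally show "mul (mul y x) (mul y x) \<in> C" .
qed (intro mul_closed x y)

text \<open>This is the colon ideal \<open>(C : x)\<close>. Rotating factors by
  \<open>radical_flat_commute\<close> makes it two-sided and radical; it supplies the larger flats
  that the maximality argument for primes compares with.\<close>

lemma radical_flat_residual:
  assumes C: "radical_flat C" and x: "x \<in> A"
  shows "radical_flat {y \<in> A. mul x y \<in> C}" (is "radical_flat ?R")
  unfolding radical_flat_def
proof (intro conjI ballI impI)
  have fl: "C \<in> flats A cl" by (rule radical_flat_flat[OF C])
  have R: "?R \<subseteq> A" by auto
  show "?R \<in> flats A cl"
  proof (rule flatI[OF R], rule subsetI)
    fix y assume y: "y \<in> cl ?R"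
    \<comment> \<open>Enlarging \<open>x\<close> to \<open>cl {x}\<close> lets the axiom
      \<open>cl_mult\<close> act on the closure of the residual.\<close>
    have "mul x y \<in> setmult mul (cl {x}) (cl ?R)"
      using cl_extensive[of "{x}"] x y by (intro setmultI) auto
    also have "\<dots> \<subseteq> cl (setmult mul {x} ?R)" using x by (intro cl_mult) auto
    also have "\<dots> \<subseteq> C" by (rule cl_least[OF _ fl]) (auto simp: setmult_def)
    finally show "y \<in> ?R" using y cl_closed[OF R] by auto
  qed
  fix y assume y: "y \<in> A"
  {
    fix z assume z: "z \<in> A" and or: "y \<in> ?R \<or> z \<in> ?R"
    have "mul x (mul y z) \<in> C"
    proof (cases "y \<in> ?R")
      case True
      then have "mul (mul x y) z \<in> C" using x y z by (intro radical_flat_mul[OF C] mul_closed) auto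
      then show ?thesis using x y z by (simp add: mul_assoc)
    next
      case False
      then have "mul z x \<in> C" using or by (intro radical_flat_commute[OF C x z]) auto
      then have "mul y (mul z x) \<in> C" using x y z by (intro radical_flat_mul[OF C] mul_closed) auto
      then have "mul (mul y z) x \<in> C" using x y z by (simp add: mul_assoc)
      then show ?thesis by (rule radical_flat_commute[OF C mul_closed[OF y z] x])
    qed
    then show "mul y z \<in> ?R" using mul_closed[OF y z] by simp
  }
  assume "mul y y \<in> ?R"
  \<comment> \<open>From \<open>xyy\<close> in \<open>C\<close>, rotation gives \<open>yxy\<close>,
    and multiplying by \<open>x\<close> on the left gives the square of \<open>xy\<close>.\<close>
  then have "mul (mul x y) y \<in> C" using x y by (simp add: mul_assoc)
  then have "mul y (mul x y) \<in> C" by (rule radical_flat_commute[OF C mul_closed[OF x y] y])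
  then have "mul x (mul y (mul x y)) \<in> C"
    using x y by (intro radical_flat_mul[OF C] mul_closed) auto
  then have "mul (mul x y) (mul x y) \<in> C" using x y by (simp add: mul_assoc mul_closed)
  then have "mul x y \<in> C" by (rule radical_flat_square[OF C mul_closed[OF x y]])
  then show "y \<in> ?R" using y by simp
qed

lemma radical_flat_carrier: "radical_flat A"
  by (simp add: radical_flat_def flatI cl_closed mul_closed)

lemma radical_flat_radical:
  assumes "S \<subseteq> A"
  shows "radical_flat (radical S)"
  unfolding radical_flat_def
proof (intro conjI ballI impI)
  have sub: "radical S \<subseteq> A" using radical_flat_carrier assms by (auto simp: radical_def)
  show "radical S \<in> flats A cl"
  proof (rule flatI[OF sub])
    have "cl (radical S) \<subseteq> C" if "radical_flat C" "S \<subseteq> C" for C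
      using that by (intro cl_least radical_flat_flat) (auto simp: radical_def)
    then show "cl (radical S) \<subseteq> radical S" by (subst (2) radical_def) blast
  qed
qed (auto simp: radical_def intro: radical_flat_mul radical_flat_square)

lemma radical_extensive: "S \<subseteq> radical S"
  by (auto simp: radical_def)

lemma radical_least: "radical_flat C \<Longrightarrow> S \<subseteq> C \<Longrightarrow> radical S \<subseteq> C"
  by (auto simp: radical_def)

lemma radical_mono: "S \<subseteq> T \<Longrightarrow> radical S \<subseteq> radical T"
  by (auto simp: radical_def)

text \<open>By finitariness an element of the closure of the union already lies in the closure of a
  finite subset, and directedness puts that subset into one member. The ideal and square conditions
  each start from a single element, so they pass to the union directly.\<close>

lemma radical_flat_directed_Union:
  assumes fin: "finitary A cl" and ne: "\<C> \<noteq> {}"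
    and rad: "\<And>C. C \<in> \<C> \<Longrightarrow> radical_flat C"
    and dir: "\<And>C D. C \<in> \<C> \<Longrightarrow> D \<in> \<C> \<Longrightarrow> \<exists>E\<in>\<C>. C \<union> D \<subseteq> E"
  shows "radical_flat (\<Union>\<C>)"
  unfolding radical_flat_def
proof (intro conjI ballI impI)
  have sub: "\<Union>\<C> \<subseteq> A" using radical_flat_subset rad by blast
  have fin_sub: "\<exists>E\<in>\<C>. S \<subseteq> E" if "finite S" "S \<subseteq> \<Union>\<C>" for S
    using that
  proof (induction S)
    case empty
    then show ?case using ne by auto
  next
    case (insert x S)
    from insert.prems obtain D where D: "D \<in> \<C>" "x \<in> D" by blast
    from insert obtain C where C: "C \<in> \<C>" "S \<subseteq> C" by blast
    obtain E where "E \<in> \<C>" "C \<union> D \<subseteq> E" using dir[OF C(1) D(1)] by blast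
    then show ?case using C(2) D(2) by blast
  qed
  show "\<Union>\<C> \<in> flats A cl"
  proof (rule flatI[OF sub], rule subsetI)
    fix x assume x: "x \<in> cl (\<Union>\<C>)"
    have "cl (\<Union>\<C>) = \<Union>{cl S | S. S \<subseteq> \<Union>\<C> \<and> finite S}"
      by (rule fin[unfolded finitary_def, rule_format, OF sub])
    then obtain S where S: "finite S" "S \<subseteq> \<Union>\<C>" "x \<in> cl S"
      using x by auto
    then obtain E where E: "E \<in> \<C>" "S \<subseteq> E" using fin_sub by blast
    then have "cl S \<subseteq> E" by (intro cl_least radical_flat_flat rad)
    then show "x \<in> \<Union>\<C>" using S E by blast
  qed
qed (use rad in \<open>auto intro: radical_flat_mul radical_flat_square\<close>)

text \<open>Zorn's lemma gives a maximal radical flat above \<open>D\<close> avoiding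
  \<open>a\<close>. It is prime because its residuals are radical flats containing it.\<close>

lemma exists_prime_flat:
  assumes fin: "finitary A cl" and D: "radical_flat D" and a: "a \<in> A" "a \<notin> D"
  shows "\<exists>P. prime_flat P \<and> D \<subseteq> P \<and> a \<notin> P"
proof -
  let ?\<Z> = "{C. radical_flat C \<and> D \<subseteq> C \<and> a \<notin> C}"
  have "\<exists>M\<in>?\<Z>. \<forall>C\<in>?\<Z>. M \<subseteq> C \<longrightarrow> C = M"
  proof (rule subset_Zorn_nonempty)
    show "?\<Z> \<noteq> {}" using D a by auto
    fix \<C> assume ne: "\<C> \<noteq> {}" and chain: "subset.chain ?\<Z> \<C>"
    have "radical_flat (\<Union>\<C>)"
    proof (rule radical_flat_directed_Union[OF fin ne])
      show "\<exists>E\<in>\<C>. C \<union> C' \<subseteq> E" if "C \<in> \<C>" "C' \<in> \<C>" for C C'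
      proof -
        have "C \<subseteq> C' \<or> C' \<subseteq> C" using chain that unfolding subset_chain_def by blast
        then show ?thesis using that by blast
      qed
    qed (use chain in \<open>unfold subset_chain_def, blast\<close>)
    then show "\<Union>\<C> \<in> ?\<Z>" using ne chain unfolding subset_chain_def by blast
  qed
  then obtain M where M_in: "M \<in> ?\<Z>" and M_max: "\<forall>C\<in>?\<Z>. M \<subseteq> C \<longrightarrow> C = M" by (rule bexE)
  then have M: "radical_flat M" "D \<subseteq> M" "a \<notin> M" by simp_all
  have max: "C = M" if C: "radical_flat C" "M \<subseteq> C" "a \<notin> C" for C
    using M_max[rule_format, of C] C M(2) by simp
  \<comment> \<open>The residual of \<open>M\<close> at \<open>x\<close> strictly contains
    \<open>M\<close>, as it contains \<open>y\<close>; by maximality it must contain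
    \<open>a\<close>.\<close>
  have grow: "mul x a \<in> M" if x: "x \<in> A" and y: "y \<in> A" "mul x y \<in> M" "y \<notin> M" for x y
  proof (rule ccontr)
    assume "mul x a \<notin> M"
    moreover have "M \<subseteq> {z \<in> A. mul x z \<in> M}"
      using x radical_flat_subset[OF M(1)] radical_flat_mul[OF M(1)] by blast
    ultimately have "{z \<in> A. mul x z \<in> M} = M"
      by (intro max radical_flat_residual M x) auto
    then show False using y by blast
  qed
  \<comment> \<open>Using \<open>grow\<close> twice replaces first \<open>y\<close> and then, after
    commuting, \<open>x\<close> by \<open>a\<close>; the square of \<open>a\<close> lands in
    \<open>M\<close>, forcing \<open>a\<close> into \<open>M\<close>.\<close>
  have "x \<in> M \<or> y \<in> M" if x: "x \<in> A" and y: "y \<in> A" and xy: "mul x y \<in> M" for x y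
  proof (rule ccontr)
    assume n: "\<not> (x \<in> M \<or> y \<in> M)"
    then have "mul x a \<in> M" using grow[OF x y xy] by simp
    then have "mul a x \<in> M" using radical_flat_commute[OF M(1) x a(1)] by simp
    then have "mul a a \<in> M" using grow[OF a(1) x] n by simp
    then show False using radical_flat_square[OF M(1) a(1)] M(3) by simp
  qed
  then have "prime_flat M"
    using radical_flat_mul[OF M(1)] radical_flat_flat[OF M(1)] unfolding prime_flat_def by metis
  then show ?thesis using M(2,3) by (intro exI[of _ M] conjI)
qed

end


section \<open>The spectrum of a covered semigroup\<close>

definition bool_frame :: "bool gorder"
  where "bool_frame = \<lparr>carrier = UNIV, eq = (=), le = (\<le>)\<rparr>"

lemma bool_frame_simps [simp]:
  "carrier bool_frame = UNIV"
  "x .=\<^bsub>bool_frame\<^esub> y \<longleftrightarrow> x = y"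
  "x \<sqsubseteq>\<^bsub>bool_frame\<^esub> y \<longleftrightarrow> x \<le> y"
  by (simp_all add: bool_frame_def)

lemma is_lub_bool_frame: "is_lub bool_frame (True \<in> S) S"
  by (rule least_UpperI) (auto simp: Upper_def)

lemma suplattice_bool_frame: "suplattice bool_frame"
proof -
  have "partial_order bool_frame"
    by unfold_locales (auto simp: bool_frame_def)
  then show ?thesis
    by (rule suplattice.intro, intro suplattice_axioms.intro) (use is_lub_bool_frame in blast)
qed

lemma sup_bool_frame: "\<Squnion>\<^bsub>bool_frame\<^esub> S \<longleftrightarrow> True \<in> S"
  using suplattice.sup_eqI[OF suplattice_bool_frame is_lub_bool_frame] by simp

lemma meet_bool_frame: "x \<sqinter>\<^bsub>bool_frame\<^esub> y \<longleftrightarrow> x \<and> y"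
  by (rule suplattice.meet_eqI[OF suplattice_bool_frame],
      rule greatest_LowerI) (auto simp: Lower_def)

lemma frame_bool_frame: "frame bool_frame"
  by (rule frame.intro[OF suplattice_bool_frame], rule frame_axioms.intro)
    (auto simp: sup_bool_frame meet_bool_frame)

locale covered_semigroup_Spec = covered_semigroup A mul cl + frame F
  for A :: "'a set" and mul :: "'a \<Rightarrow> 'a \<Rightarrow> 'a" and cl :: "'a set \<Rightarrow> 'a set"
    and F :: "'f gorder" (structure) and \<phi> :: "'a set \<Rightarrow> 'f" +
  assumes is_Spec: "is_Spec (flat_quantale A mul cl) F \<phi>"
begin

section \<open>Generators of the spectrum and their calculus\<close>

lemma flat_quantale_simps:
  "carrier (flat_quantale A mul cl) = flats A cl"
  "C \<odot>\<^bsub>flat_quantale A mul cl\<^esub> D = cl (setmult mul C D)"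
  by (simp_all add: flat_quantale_def)

lemma strong: "strong_morphism (flat_quantale A mul cl) (frame_quantale F) \<phi>"
  using is_Spec by (simp add: is_Spec_def)

lemma Spec_closed: "C \<in> flats A cl \<Longrightarrow> \<phi> C \<in> carrier F"
  using strong by (auto simp: strong_morphism_def flat_quantale_simps)

lemma Spec_sup: "\<S> \<subseteq> flats A cl \<Longrightarrow> \<phi> (cl (\<Union>\<S>)) = \<Squnion>(\<phi> ` \<S>)"
  using strong unfolding strong_morphism_def by (simp add: flat_quantale_simps sup_flats[symmetric])

lemma Spec_mult:
  "C \<in> flats A cl \<Longrightarrow> D \<in> flats A cl \<Longrightarrow> \<phi> (cl (setmult mul C D)) = \<phi> C \<sqinter> \<phi> D"
  using strong unfolding strong_morphism_def by (simp add: flat_quantale_simps)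

lemma Spec_surj:
  assumes "U \<in> carrier F"
  obtains C where "C \<in> flats A cl" "U = \<phi> C"
  using is_Spec_surj[OF quantale_flats is_Spec] assms
  by (force simp: flat_quantale_simps)

text \<open>A singleton need not be flat, so \<open>a\<close> enters the spectrum through its
  closure. These images generate \<open>F\<close> under joins.\<close>

definition elt :: "'a \<Rightarrow> 'f"
  where "elt a = \<phi> (cl {a})"

lemma elt_closed: "a \<in> A \<Longrightarrow> elt a \<in> carrier F"
  by (simp add: elt_def Spec_closed cl_flat)

lemma elt_mul:
  assumes "a \<in> A" "b \<in> A"
  shows "elt (mul a b) = elt a \<sqinter> elt b"
proof -
  have "elt a \<sqinter> elt b = \<phi> (cl (setmult mul (cl {a}) (cl {b})))"
    using assms by (simp add: elt_def Spec_mult cl_flat)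
  also have "cl (setmult mul (cl {a}) (cl {b})) = cl (setmult mul {a} {b})"
    using assms by (intro cl_setmult_cl) auto
  also have "setmult mul {a} {b} = {mul a b}" by (auto simp: setmult_def)
  finally show ?thesis by (simp add: elt_def)
qed

lemma Spec_cl: "S \<subseteq> A \<Longrightarrow> \<phi> (cl S) = \<Squnion>(elt ` S)"
proof -
  assume S: "S \<subseteq> A"
  \<comment> \<open>Seeing \<open>S\<close> as a union of singletons turns its closure into a join
    of principal flats.\<close>
  have "cl (\<Union>(cl ` (\<lambda>a. {a}) ` S)) = cl (\<Union>((\<lambda>a. {a}) ` S))"
    by (rule cl_Union_cl) (use S in auto)
  then have "\<phi> (cl S) = \<phi> (cl (\<Union>((\<lambda>a. cl {a}) ` S)))" by (simp add: image_image)
  also have "\<dots> = \<Squnion>(\<phi> ` (\<lambda>a. cl {a}) ` S)"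
    using S by (intro Spec_sup) (auto intro!: cl_flat)
  finally show ?thesis by (simp add: image_image elt_def)
qed

lemma Spec_flat: "C \<in> flats A cl \<Longrightarrow> \<phi> C = \<Squnion>(elt ` C)"
  using Spec_cl[of C] by (simp add: flats_def)

lemma Spec_flat_le_iff:
  "C \<in> flats A cl \<Longrightarrow> U \<in> carrier F \<Longrightarrow> \<phi> C \<sqsubseteq> U \<longleftrightarrow> (\<forall>a\<in>C. elt a \<sqsubseteq> U)"
  using flat_subset[of C] by (subst Spec_flat, simp, subst le_sup_iff) (auto intro!: elt_closed)

text \<open>For \<open>U\<close> in \<open>F\<close> this is the largest flat with image below
  \<open>U\<close>: the right adjoint of \<open>\<phi>\<close>.\<close>

definition flat_below :: "'f \<Rightarrow> 'a set"
  where "flat_below U = {a \<in> A. elt a \<sqsubseteq> U}"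

text \<open>Products in \<open>A\<close> become meets in \<open>F\<close>. A meet lies below either
  factor, which gives the ideal condition, and meet is idempotent, which gives the square
  condition.\<close>

lemma radical_flat_below:
  assumes U: "U \<in> carrier F"
  shows "radical_flat (flat_below U)"
  unfolding radical_flat_def
proof (intro conjI ballI impI)
  have sub: "flat_below U \<subseteq> A" by (auto simp: flat_below_def)
  show "flat_below U \<in> flats A cl"
  proof (rule flatI[OF sub], rule subsetI)
    fix a assume a: "a \<in> cl (flat_below U)"
    have "\<phi> (cl (flat_below U)) \<sqsubseteq> U"
      unfolding Spec_cl[OF sub] using U
      by (subst le_sup_iff) (auto simp: flat_below_def elt_closed)
    then have "elt a \<sqsubseteq> U" using a Spec_flat_le_iff[OF cl_flat[OF sub] U] by simp
    then show "a \<in> flat_below U" using a cl_closed[OF sub] by (auto simp: flat_below_def)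
  qed
  fix a assume a: "a \<in> A"
  {
    fix b assume b: "b \<in> A" and or: "a \<in> flat_below U \<or> b \<in> flat_below U"
    then have "elt a \<sqinter> elt b \<sqsubseteq> U"
      using a b U elt_closed unfolding flat_below_def
      by (metis (mono_tags, lifting) le_trans mem_Collect_eq meet_closed meet_left meet_right)
    then show "mul a b \<in> flat_below U" using a b by (simp add: flat_below_def elt_mul mul_closed)
  }
  assume "mul a a \<in> flat_below U"
  then have "elt a \<sqinter> elt a \<sqsubseteq> U" using a by (simp add: flat_below_def elt_mul)
  moreover have "elt a \<sqsubseteq> elt a \<sqinter> elt a" using a by (simp add: le_meet_iff elt_closed)
  ultimately have "elt a \<sqsubseteq> U" using a U by (meson le_trans meet_closed elt_closed)
  then show "a \<in> flat_below U" using a by (simp add: flat_below_def)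
qed

text \<open>
  This is where initiality enters: \<open>P\<close> defines a strong morphism to the two-element frame, which
  factors through \<open>\<phi>\<close>.
\<close>

lemma Spec_prime_flat_le_iff:
  assumes P: "prime_flat P" and C: "C \<in> flats A cl"
  shows "\<phi> C \<sqsubseteq> \<phi> P \<longleftrightarrow> C \<subseteq> P"
proof
  have Pfl: "P \<in> flats A cl" using P by (simp add: prime_flat_def)
  let ?Q = "flat_quantale A mul cl" and ?\<psi> = "\<lambda>C. \<not> C \<subseteq> P"
  \<comment> \<open>The map tests whether a flat escapes \<open>P\<close>. A join escapes iff some
    member does, and primality of \<open>P\<close> makes a product escape iff both factors
    do.\<close>
  have "strong_morphism ?Q (frame_quantale bool_frame) ?\<psi>"
    unfolding strong_morphism_def flat_quantale_simps frame_quantale_simps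
  proof (intro conjI allI impI ballI)
    fix \<S> assume S: "\<S> \<subseteq> flats A cl"
    then have "\<Union>\<S> \<subseteq> A" by (auto simp: flats_def)
    then show "(\<not> \<Squnion>\<^bsub>?Q\<^esub> \<S> \<subseteq> P) = \<Squnion>\<^bsub>bool_frame\<^esub> (?\<psi> ` \<S>)"
      unfolding sup_flats[OF S] sup_bool_frame by (simp add: cl_subset_iff Pfl) blast
  next
    fix C D assume C: "C \<in> flats A cl" and D: "D \<in> flats A cl"
    have "cl (setmult mul C D) \<subseteq> P \<longleftrightarrow> setmult mul C D \<subseteq> P"
      by (intro cl_subset_iff Pfl setmult_closed flat_subset C D)
    also have "\<dots> \<longleftrightarrow> (\<forall>c\<in>C. \<forall>d\<in>D. mul c d \<in> P)" by (auto simp: setmult_def)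
    also have "\<dots> \<longleftrightarrow> (\<forall>c\<in>C. \<forall>d\<in>D. c \<in> P \<or> d \<in> P)"
      using P flat_subset[OF C] flat_subset[OF D] unfolding prime_flat_def by blast
    also have "\<dots> \<longleftrightarrow> C \<subseteq> P \<or> D \<subseteq> P" by blast
    finally show "(\<not> cl (setmult mul C D) \<subseteq> P) = (\<not> C \<subseteq> P) \<sqinter>\<^bsub>bool_frame\<^esub> (\<not> D \<subseteq> P)"
      by (simp add: meet_bool_frame)
  qed simp
  then obtain \<eta> where \<eta>: "strong_morphism (frame_quantale F) (frame_quantale bool_frame) \<eta>"
    "\<forall>C\<in>carrier ?Q. \<eta> (\<phi> C) = ?\<psi> C"
    \<comment> \<open>The type \<open>bool\<close> is not among those quantified in
      \<open>is_Spec\<close>, so the type-independent form of initiality is used.\<close>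
    using is_Spec_initial[OF quantale_flats is_Spec, unfolded initial_among_frames_def, rule_format,
        OF conjI, OF frame_bool_frame]
    by blast
  assume le: "\<phi> C \<sqsubseteq> \<phi> P"
  \<comment> \<open>Since \<open>P\<close> does not escape itself, \<open>\<eta>\<close> sends
    \<open>\<phi> P\<close> to \<open>False\<close>, hence also everything below it.\<close>
  have "\<phi> C = \<phi> C \<sqinter> \<phi> P"
    using le C Pfl by (intro le_antisym) (auto simp: le_meet_iff Spec_closed meet_left)
  also have "\<eta> \<dots> \<longleftrightarrow> \<eta> (\<phi> C) \<and> \<eta> (\<phi> P)"
    using \<eta>(1) C Pfl by (simp add: strong_morphism_def meet_bool_frame Spec_closed)
  finally show "C \<subseteq> P" using \<eta>(2) C Pfl by (simp add: flat_quantale_simps)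
next
  have Pfl: "P \<in> flats A cl" using P by (simp add: prime_flat_def)
  assume "C \<subseteq> P"
  then show "\<phi> C \<sqsubseteq> \<phi> P"
    using C Pfl Spec_flat_le_iff[OF Pfl, of "\<phi> P"] by (auto simp: Spec_flat_le_iff Spec_closed)
qed

lemma elt_le_prime_flat_iff:
  assumes "prime_flat P" "a \<in> A"
  shows "elt a \<sqsubseteq> \<phi> P \<longleftrightarrow> a \<in> P"
  using Spec_prime_flat_le_iff[OF assms(1) cl_flat, of "{a}"] assms
  by (simp add: elt_def cl_subset_iff prime_flat_def)

text \<open>The witness \<open>a\<close> keeps \<open>\<phi> P\<close> from being the top. For
  primality, surjectivity of \<open>\<phi>\<close> represents both elements by flats, whose product
  has the meet as its image.\<close>

lemma pt_prime_flat:
  assumes P: "prime_flat P" and a: "a \<in> A" "a \<notin> P"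
  shows "\<phi> P \<in> pt F"
  unfolding pt_def
proof (intro CollectI conjI ballI impI)
  have Pfl: "P \<in> flats A cl" using P by (simp add: prime_flat_def)
  then show "\<phi> P \<in> carrier F" by (rule Spec_closed)
  show "\<phi> P \<noteq> \<top>"
    using elt_le_prime_flat_iff[OF P a(1)] a top_higher[OF elt_closed[OF a(1)]] by auto
  fix U V assume "U \<in> carrier F" "V \<in> carrier F" and le: "U \<sqinter> V \<sqsubseteq> \<phi> P"
  then obtain C D where C: "C \<in> flats A cl" "U = \<phi> C" and D: "D \<in> flats A cl" "V = \<phi> D"
    by (metis Spec_surj)
  have sm: "setmult mul C D \<subseteq> A" by (intro setmult_closed flat_subset C D)
  have "\<phi> (cl (setmult mul C D)) \<sqsubseteq> \<phi> P" using le C D by (simp add: Spec_mult)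
  then have "setmult mul C D \<subseteq> P"
    using Spec_prime_flat_le_iff[OF P cl_flat[OF sm]] cl_extensive[OF sm] by blast
  then have "C \<subseteq> P \<or> D \<subseteq> P"
    using P flat_subset[OF C(1)] flat_subset[OF D(1)] setmultI[of _ C _ D]
    unfolding prime_flat_def by blast
  then show "U \<sqsubseteq> \<phi> P \<or> V \<sqsubseteq> \<phi> P" using C D Spec_prime_flat_le_iff[OF P] by auto
qed

text \<open>Some generator \<open>elt a\<close> below \<open>U\<close> is not below
  \<open>V\<close>. So \<open>flat_below V\<close> is a radical flat avoiding \<open>a\<close>, and
  a prime flat above it that still avoids \<open>a\<close> yields the point.\<close>

lemma points_separate:
  assumes fin: "finitary A cl" and U: "U \<in> carrier F" and V: "V \<in> carrier F" and "\<not> U \<sqsubseteq> V"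
  shows "\<exists>p\<in>pt F. V \<sqsubseteq> p \<and> \<not> U \<sqsubseteq> p"
proof -
  obtain C D where C: "C \<in> flats A cl" "U = \<phi> C" and D: "D \<in> flats A cl" "V = \<phi> D"
    using U V by (metis Spec_surj)
  then obtain a where a: "a \<in> C" "\<not> elt a \<sqsubseteq> V"
    using Spec_flat_le_iff[OF C(1) V] assms(4) by auto
  have aA: "a \<in> A" using a flat_subset[OF C(1)] by auto
  have "a \<notin> flat_below V" using a by (simp add: flat_below_def)
  then obtain P where P: "prime_flat P" "flat_below V \<subseteq> P" "a \<notin> P"
    using exists_prime_flat[OF fin radical_flat_below[OF V] aA] by blast
  have "D \<subseteq> flat_below V"
    using Spec_flat_le_iff[OF D(1) V] D V flat_subset[OF D(1)] by (auto simp: flat_below_def)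
  then have "V \<sqsubseteq> \<phi> P" using Spec_prime_flat_le_iff[OF P(1) D(1)] D P by blast
  moreover have "\<not> U \<sqsubseteq> \<phi> P" using Spec_prime_flat_le_iff[OF P(1) C(1)] C P a by blast
  ultimately show ?thesis using pt_prime_flat[OF P(1) aA P(3)] by blast
qed

text \<open>A cover of the open set of \<open>elt a\<close> forces \<open>a\<close> into the
  directed union of the radical flats generated by finite subfamilies: otherwise a prime flat would
  give an uncovered point. One finite subfamily then suffices.\<close>

lemma compactin_pt_open_elt:
  assumes fin: "finitary A cl" and a: "a \<in> A"
  shows "compactin (pt_topology F) (pt_open F (elt a))"
  unfolding compactin_def topspace_pt_topology
proof (intro conjI allI impI pt_open_subset, elim conjE)
  fix \<U> assume op: "Ball \<U> (openin (pt_topology F))" and cover: "pt_open F (elt a) \<subseteq> \<Union>\<U>"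
  then have "\<forall>W\<in>\<U>. \<exists>S\<in>carrier F. W = pt_open F S" by (simp add: openin_pt_topology)
  then obtain g where g: "\<And>W. W \<in> \<U> \<Longrightarrow> g W \<in> carrier F"
    "\<And>W. W \<in> \<U> \<Longrightarrow> W = pt_open F (g W)"
    by metis
  define E where "E J = radical (\<Union>W\<in>J. flat_below (g W))" for J
  have sub: "(\<Union>W\<in>J. flat_below (g W)) \<subseteq> A" for J by (auto simp: flat_below_def)
  \<comment> \<open>Indexing by finite \<open>J\<close> makes the family directed; the empty
    \<open>J\<close> keeps it non-empty even for an empty cover.\<close>
  let ?\<C> = "E ` {J. finite J \<and> J \<subseteq> \<U>}"
  have rad: "radical_flat (\<Union>?\<C>)"
  proof (rule radical_flat_directed_Union[OF fin])
    fix C D assume "C \<in> ?\<C>" "D \<in> ?\<C>"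
    then obtain J K where J: "finite J" "J \<subseteq> \<U>" "C = E J" and K: "finite K" "K \<subseteq> \<U>" "D = E K"
      by auto
    have "E J \<subseteq> E (J \<union> K)" "E K \<subseteq> E (J \<union> K)" unfolding E_def by (intro radical_mono, blast)+
    then show "\<exists>B\<in>?\<C>. C \<union> D \<subseteq> B" using J K by (intro bexI[of _ "E (J \<union> K)"]) auto
  qed (use radical_flat_radical[OF sub] in \<open>auto simp: E_def\<close>)
  have "a \<in> \<Union>?\<C>"
  proof (rule ccontr)
    assume "a \<notin> \<Union>?\<C>"
    then obtain P where P: "prime_flat P" "\<Union>?\<C> \<subseteq> P" "a \<notin> P"
      using exists_prime_flat[OF fin rad a] by blast
    have "\<phi> P \<in> pt_open F (elt a)"
      using pt_prime_flat[OF P(1) a P(3)] elt_le_prime_flat_iff[OF P(1) a] P(3)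
      by (simp add: pt_open_def)
    then obtain W where W: "W \<in> \<U>" "\<phi> P \<in> W" using cover by blast
    obtain C where C: "C \<in> flats A cl" "g W = \<phi> C" using Spec_surj[OF g(1)[OF W(1)]] by blast
    have "C \<subseteq> flat_below (g W)"
      using Spec_flat_le_iff[OF C(1) g(1)[OF W(1)]] C g(1)[OF W(1)] flat_subset[OF C(1)]
      by (auto simp: flat_below_def)
    also have "\<dots> \<subseteq> E {W}" unfolding E_def using radical_extensive by auto
    also have "\<dots> \<subseteq> \<Union>?\<C>" using W(1) by blast
    finally have "g W \<sqsubseteq> \<phi> P" using P(2) C Spec_prime_flat_le_iff[OF P(1) C(1)] by auto
    then show False using W(2) g(2)[OF W(1)] by (auto simp: pt_open_def)
  qed
  then obtain J where J: "finite J" "J \<subseteq> \<U>" "a \<in> E J" by auto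
  \<comment> \<open>A point \<open>p\<close> outside every \<open>W\<close> in \<open>J\<close> lies
    above each \<open>g W\<close>, so \<open>flat_below p\<close> is a radical flat containing
    \<open>E J\<close> and hence \<open>a\<close>.\<close>
  have "pt_open F (elt a) \<subseteq> \<Union>J"
  proof (rule subsetI, rule ccontr)
    fix p assume p: "p \<in> pt_open F (elt a)" "p \<notin> \<Union>J"
    then have pc: "p \<in> carrier F" "p \<in> pt F" by (auto simp: pt_open_def pt_carrier)
    have "flat_below (g W) \<subseteq> flat_below p" if "W \<in> J" for W
    proof -
      have W: "W \<in> \<U>" using that J by auto
      then have "g W \<sqsubseteq> p" using p(2) pc that g(2)[OF W] by (auto simp: pt_open_def)
      then show ?thesis using le_trans[OF _ \<open>g W \<sqsubseteq> p\<close> elt_closed g(1)[OF W] pc(1)]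
        by (auto simp: flat_below_def)
    qed
    then have "E J \<subseteq> flat_below p"
      unfolding E_def by (intro radical_least radical_flat_below pc) auto
    then show False using J p by (auto simp: flat_below_def pt_open_def)
  qed
  then show "\<exists>\<F>. finite \<F> \<and> \<F> \<subseteq> \<U> \<and> pt_open F (elt a) \<subseteq> \<Union>\<F>" using J by blast
qed

lemma quasi_spectral_pt_topology:
  assumes fin: "finitary A cl"
  shows "quasi_spectral (pt_topology F)"
  unfolding quasi_spectral_def
proof (intro conjI t0_space_pt_topology sober_pt_topology exI[of _ "(\<lambda>a. pt_open F (elt a)) ` A"])
  let ?\<B> = "(\<lambda>a. pt_open F (elt a)) ` A"
  show "\<forall>U\<in>?\<B>. openin (pt_topology F) U \<and> compactin (pt_topology F) U"
    by (auto simp: openin_pt_open elt_closed compactin_pt_open_elt[OF fin])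
  show "\<forall>U. openin (pt_topology F) U \<longrightarrow> (\<exists>\<C>\<subseteq>?\<B>. U = \<Union>\<C>)"
  proof (intro allI impI)
    fix U assume "openin (pt_topology F) U"
    then obtain S where S: "S \<in> carrier F" "U = pt_open F S" by (auto simp: openin_pt_topology)
    then obtain C where C: "C \<in> flats A cl" "S = \<phi> C" by (metis Spec_surj)
    have "U = \<Union>(pt_open F ` elt ` C)"
      unfolding S(2) C(2) Spec_flat[OF C(1)] using flat_subset[OF C(1)]
      by (intro pt_open_sup) (auto intro: elt_closed)
    then show "\<exists>\<C>\<subseteq>?\<B>. U = \<Union>\<C>"
      using flat_subset[OF C(1)] by (intro exI[of _ "pt_open F ` elt ` C"]) auto
  qed
  show "\<forall>U\<in>?\<B>. \<forall>V\<in>?\<B>. U \<inter> V \<in> ?\<B>"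
    by (auto simp: pt_open_meet[symmetric] elt_closed elt_mul[symmetric] mul_closed)
qed

text \<open>A unit \<open>e\<close> makes \<open>elt a\<close> equal to the meet of
  \<open>elt e\<close> and \<open>elt a\<close>, so \<open>elt e\<close> is the top and the whole
  space is a basic quasi-compact open set.\<close>

lemma compact_space_pt_topology:
  assumes fin: "finitary A cl" and unit: "has_unit A mul"
  shows "compact_space (pt_topology F)"
proof -
  obtain e where e: "e \<in> A" "\<And>a. a \<in> A \<Longrightarrow> mul e a = a" using unit by (auto simp: has_unit_def)
  have "elt a \<sqsubseteq> elt e" if "a \<in> A" for a
    using meet_left[OF elt_closed[OF e(1)] elt_closed[OF that]] elt_mul[OF e(1) that] e(2)[OF that]
    by simp
  then have le: "U \<sqsubseteq> elt e" if "U \<in> carrier F" for U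
    using that flat_subset Spec_flat_le_iff[OF _ elt_closed[OF e(1)]] by (metis Spec_surj subsetD)
  then have "elt e = \<top>" using e(1) by (intro le_antisym top_higher elt_closed) auto
  then have "pt_open F (elt e) = pt F" by (simp add: pt_open_top)
  then show ?thesis
    using compactin_pt_open_elt[OF fin e(1)] by (simp add: compact_space_def topspace_pt_topology)
qed

end

theorem proposition2p52:
  fixes A :: "'a set" and mul :: "'a \<Rightarrow> 'a \<Rightarrow> 'a" and cl :: "'a set \<Rightarrow> 'a set"
    and F :: "'f gorder" and \<phi> :: "'a set \<Rightarrow> 'f"
  assumes "covered_semigroup A mul cl"
    and "is_Spec (flat_quantale A mul cl) F \<phi>"
    and "finitary A cl"
  shows "spatial F \<and> quasi_spectral (pt_topology F) \<and>
    (has_unit A mul \<longrightarrow> spectral (pt_topology F))"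
proof -
  interpret covered_semigroup_Spec A mul cl F \<phi>
    using assms(1,2)
    by (simp add: covered_semigroup_Spec_def covered_semigroup_Spec_axioms_def is_Spec_def)
  have "spatial F"
    by (rule spatial_if_points_separate[OF frame_axioms points_separate[OF assms(3)]])
  then show ?thesis
    using quasi_spectral_pt_topology compact_space_pt_topology assms(3)
    by (simp add: spectral_def)
qed

end
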